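(* Let $k,n$ be positive integers and $N$ a prime with $N\ge n$. There exists a black-box reduction that converts any non-cyclic $(n,b,d,\delta)$ $k$D-LPHS into an $(N,b,d,\delta+d^2/N)$ $k$D-DDL algorithm. Moreover, this DDL algorithm is query-restricted, in the sense that every generic query $(\alpha,(\beta_1,\dots,\beta_k))$ it makes satisfies $\alpha=1$ and $\beta_i\in\{0,1,\dots,n-1\}$ for all $i$.
   Context: Let $\Sigma_b=\{0,1\}^b$ and let $e_i$ denote the $i$-th unit vector of length $k$. Non-cyclic $k$D-LPHS: a function $h:\Sigma_b^{\mathbb{Z}_n^k}\to\mathbb{Z}^k$ (possibly randomized) is a non-cyclic $(n,b,d,\delta)$ $k$D-LPHS if it can be computed by $d$ adaptive queries of the form $x[\beta_1,\dots,\beta_k]$ ($\beta_i\in\{0,\dots,n-1\}$) to $x\in\Sigma_b^{\mathbb{Z}_n^k}$ and for every $i\in[k]$, $\Pr_x[h(x)\neq h(x\lll e_i)+e_i]\le\delta$ for uniform $x$, where $x\lll e_i$ is the randomized non-cyclic shift by one in dimension $i$: entries are moved one step towards smaller index in dimension $i$, the entries with index $0$ in dimension $i$ are dropped and the entries with index $n-1$ in dimension $i$ are filled with fresh uniform symbols. $k$D-DDL in the generic group model: a string $X\in\Sigma_b^{\mathbb{Z}_N}$ (labels of the elements of a group of order $N$ with generator $g$, $X[t]$ labelling $g^t$), a value $v\in\mathbb{Z}_N$ and a basis $w=(w_1,\dots,w_k)\in\mathbb{Z}_N^k$ are sampled uniformly and independently. A generic algorithm $A^{G,w}(X,v)$ knows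 $w$ but has no direct access to $X,v$; it makes adaptive queries $(\alpha,(\beta_1,\dots,\beta_k))\in\mathbb{Z}_N\times\mathbb{Z}_N^k$, each answered by $X[\alpha v+\sum_i\beta_iw_i \bmod N]$, and outputs a vector in $\mathbb{Z}^k$. $A$ is an $(N,b,d,\delta)$ $k$D-DDL algorithm if it makes $d$ queries and for every $i\in[k]$, $\Pr[A^{G,w}(X,v)-A^{G,w}(X,v+w_i)\neq e_i]\le\delta$, the probability being over $X,v,w$ and the internal randomness of $A$ (shared between the two executions). *)

theory Defs
  imports "HOL-Probability.Probability" "HOL-Computational_Algebra.Primes"
begin

section \<open>Adaptive query algorithms\<close>

text \<open>A deterministic adaptive query algorithm is a decision tree. A randomized one is a
  \<open>pmf\<close> on trees: drawing the tree is drawing all internal coins, so running the drawn tree on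
  two inputs is running the algorithm twice with shared randomness.\<close>

datatype ('q, 'a, 'o) qtree =
    Return 'o
  | Query 'q "'a \<Rightarrow> ('q, 'a, 'o) qtree"

primrec eval_tree :: "('q, 'a, 'o) qtree \<Rightarrow> ('q \<Rightarrow> 'a) \<Rightarrow> 'o" where
  "eval_tree (Return z) ora = z"
| "eval_tree (Query q f) ora = eval_tree (f (ora q)) ora"

text \<open>In the next two notions \<open>S\<close> is the set of legal answers; branches of a tree that are
  labelled by elements outside \<open>S\<close> are unreachable and do not count.\<close>

primrec at_most_queries :: "'a set \<Rightarrow> ('q, 'a, 'o) qtree \<Rightarrow> nat \<Rightarrow> bool" where
  "at_most_queries S (Return z) d = True"
| "at_most_queries S (Query q f) d = (d > 0 \<and> (\<forall>a\<in>S. at_most_queries S (f a) (d - 1)))"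

primrec queries :: "'a set \<Rightarrow> ('q, 'a, 'o) qtree \<Rightarrow> 'q set" where
  "queries S (Return z) = {}"
| "queries S (Query q f) = insert q (\<Union>a\<in>S. queries S (f a))"

section \<open>Strings\<close>

type_synonym label = "bool list"

definition labels :: "nat \<Rightarrow> label set" where
  "labels b = {s. length s = b}"

lemma finite_labels: "finite (labels b)"
  using finite_lists_length_eq[of "UNIV :: bool set" b] by (simp add: labels_def)

lemma replicate_in_labels: "replicate b a \<in> labels b"
  by (simp add: labels_def)

text \<open>Both \<open>\<int>\<^sub>m\<close> and \<open>\<int>\<^sub>m\<^sup>k\<close> are represented by the
  representatives in \<open>{0..m-1}\<close>; the dimension is \<open>k = CARD('k)\<close>.\<close>

definition box :: "nat \<Rightarrow> (int ^ 'k) set" where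
  "box m = {\<beta>. \<forall>i. \<beta> $ i \<in> {0..<int m}}"

lemma finite_box: "finite (box m :: (int ^ 'k::finite) set)"
proof (rule finite_subset)
  show "box m \<subseteq> vec_lambda ` (UNIV \<rightarrow>\<^sub>E {0..<int m} :: ('k \<Rightarrow> int) set)"
  proof
    fix \<beta> :: "int ^ 'k" assume "\<beta> \<in> box m"
    then have "vec_nth \<beta> \<in> UNIV \<rightarrow>\<^sub>E {0..<int m}" by (auto simp: box_def)
    then show "\<beta> \<in> vec_lambda ` (UNIV \<rightarrow>\<^sub>E {0..<int m})"
      by (metis image_eqI vec_nth_inverse)
  qed
qed (intro finite_imageI finite_PiE; simp)

lemma zero_in_box: "m > 0 \<Longrightarrow> 0 \<in> box m"
  by (simp add: box_def)

abbreviation unit_vec :: "'k \<Rightarrow> int ^ 'k" where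
  "unit_vec i \<equiv> axis i 1"

definition uniform_string :: "'q set \<Rightarrow> nat \<Rightarrow> ('q \<Rightarrow> label) pmf" where
  "uniform_string D b = pmf_of_set (D \<rightarrow>\<^sub>E labels b)"

lemma set_pmf_uniform_string:
  assumes "finite D"
  shows "set_pmf (uniform_string D b) = D \<rightarrow>\<^sub>E labels b"
proof -
  have "finite (D \<rightarrow>\<^sub>E labels b)"
    using assms finite_labels by (intro finite_PiE) auto
  moreover have "D \<rightarrow>\<^sub>E labels b \<noteq> {}"
    using replicate_in_labels by (auto simp: PiE_eq_empty_iff)
  ultimately show ?thesis
    by (simp add: uniform_string_def set_pmf_of_set)
qed

definition noncyclic_shift ::
    "nat \<Rightarrow> nat \<Rightarrow> 'k \<Rightarrow> (int ^ 'k \<Rightarrow> label) \<Rightarrow> (int ^ 'k::finite \<Rightarrow> label) pmf" where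
  "noncyclic_shift n b i x =
     map_pmf (\<lambda>fresh. \<lambda>\<beta>\<in>box n. if \<beta> $ i = int n - 1 then fresh \<beta> else x (\<beta> + unit_vec i))
       (uniform_string {\<beta> \<in> box n. \<beta> $ i = int n - 1} b)"

section \<open>Non-cyclic LPHS\<close>

type_synonym 'k lphs_tree = "(int ^ 'k, label, int ^ 'k) qtree"

definition noncyclic_lphs ::
    "nat \<Rightarrow> nat \<Rightarrow> nat \<Rightarrow> real \<Rightarrow> 'k::finite lphs_tree pmf \<Rightarrow> bool" where
  "noncyclic_lphs n b d \<delta> h \<longleftrightarrow>
     (\<forall>t\<in>set_pmf h. at_most_queries (labels b) t d \<and> queries (labels b) t \<subseteq> box n) \<and>
     (\<forall>i. measure_pmf.prob
        (do { t \<leftarrow> h;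
              x \<leftarrow> uniform_string (box n) b;
              x' \<leftarrow> noncyclic_shift n b i x;
              return_pmf (eval_tree t x, eval_tree t x') })
        {(z, z'). z \<noteq> z' + unit_vec i} \<le> \<delta>)"

section \<open>Distributed discrete logarithm in the generic group model\<close>

type_synonym 'k generic_tree = "(int \<times> (int ^ 'k), label, int ^ 'k) qtree"

text \<open>The argument of type \<open>int ^ 'k\<close> is the basis \<open>w\<close>, which the algorithm
  knows in the clear.\<close>

type_synonym 'k generic_alg = "int ^ 'k \<Rightarrow> 'k generic_tree pmf"

definition group_oracle ::
    "nat \<Rightarrow> (int \<Rightarrow> label) \<Rightarrow> int ^ 'k \<Rightarrow> int \<Rightarrow> int \<times> (int ^ 'k::finite) \<Rightarrow> label" where
  "group_oracle N X w v = (\<lambda>(\<alpha>, \<beta>). X ((\<alpha> * v + (\<Sum>i\<in>UNIV. \<beta> $ i * w $ i)) mod int N))"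

definition ddl_algorithm ::
    "nat \<Rightarrow> nat \<Rightarrow> nat \<Rightarrow> real \<Rightarrow> 'k::finite generic_alg \<Rightarrow> bool" where
  "ddl_algorithm N b d \<delta> A \<longleftrightarrow>
     (\<forall>w\<in>box N. \<forall>t\<in>set_pmf (A w).
        at_most_queries (labels b) t d \<and> queries (labels b) t \<subseteq> {0..<int N} \<times> box N) \<and>
     (\<forall>i. measure_pmf.prob
        (do { X \<leftarrow> uniform_string {0..<int N} b;
              v \<leftarrow> pmf_of_set {0..<int N};
              w \<leftarrow> pmf_of_set (box N);
              t \<leftarrow> A w;
              return_pmf (eval_tree t (group_oracle N X w v),
                          eval_tree t (group_oracle N X w ((v + w $ i) mod int N))) })
        {(z, z'). z - z' \<noteq> unit_vec i} \<le> \<delta>)"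

definition query_restricted :: "nat \<Rightarrow> nat \<Rightarrow> nat \<Rightarrow> 'k::finite generic_alg \<Rightarrow> bool" where
  "query_restricted n N b A \<longleftrightarrow>
     (\<forall>w\<in>box N. \<forall>t\<in>set_pmf (A w). \<forall>(\<alpha>, \<beta>)\<in>queries (labels b) t. \<alpha> = 1 \<and> \<beta> \<in> box n)"

section \<open>Black-box reductions\<close>

text \<open>Black-box access to a query algorithm (with its coins fixed) is access to its next-step
  function: submit the answers to its first queries, receive its next query or its output.
  Superfluous answers are ignored.\<close>

primrec next_step :: "('q, 'a, 'o) qtree \<Rightarrow> 'a list \<Rightarrow> 'q + 'o" where
  "next_step (Return z) as = Inr z"
| "next_step (Query q f) as = (case as of [] \<Rightarrow> Inl q | a # as' \<Rightarrow> next_step (f a) as')"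

text \<open>The code of a reduction: an oracle program that may query the generic group, may query
  the next-step function of the given hash function (with rewinding), and finally
  outputs a vector. It refers to the hash function in no other way.\<close>

datatype ('g, 'q, 'a, 'o) prog =
    Output 'o
  | Ask_Group 'g "'a \<Rightarrow> ('g, 'q, 'a, 'o) prog"
  | Ask_Hash "'a list" "'q + 'o \<Rightarrow> ('g, 'q, 'a, 'o) prog"

primrec link :: "('g, 'q, 'a, 'o) prog \<Rightarrow> ('q, 'a, 'o) qtree \<Rightarrow> ('g, 'a, 'o) qtree" where
  "link (Output z) t = Return z"
| "link (Ask_Group q f) t = Query q (\<lambda>a. link (f a) t)"
| "link (Ask_Hash as f) t = link (f (next_step t as)) t"

text \<open>A reduction sees the basis \<open>w\<close> and has coins of its own, independent of the coins of the
  hash function.\<close>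

type_synonym 'k reduction =
  "int ^ 'k \<Rightarrow> (int \<times> (int ^ 'k), int ^ 'k, label, int ^ 'k) prog pmf"

definition apply_reduction :: "'k reduction \<Rightarrow> 'k lphs_tree pmf \<Rightarrow> 'k generic_alg" where
  "apply_reduction R h w = do { t \<leftarrow> h; p \<leftarrow> R w; return_pmf (link p t) }"

end

theory Submission
  imports Defs
begin

text \<open>The reduction runs the hash function on the string \<open>\<beta> \<mapsto> X[v + \<beta> \<cdot> w]\<close>. Replacing \<open>v\<close> by
  \<open>v + w\<^sub>i\<close> shifts this string, and the string looks uniform as long as distinct indices meet
  distinct group elements.

  A plain union bound over all pairs among the \<open>2d\<close> queries of the two runs gives about
  \<open>2d\<^sup>2/N\<close>. To reach \<open>d\<^sup>2/N\<close>, the reduction answers an index that collides with an earlier one of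
  the same run by a random function \<open>G\<close> of the answers so far. Then collisions within one run are
  harmless, unless both runs read the same coin although the hash function should get independent
  answers; this can only hurt at the step \<open>m\<close> (counted from \<open>0\<close>) where the answers of the two runs
  first differ, at a cost of \<open>m/N\<close>. Up to that step the two runs query the same indices, so that
  \<open>m + 1\<close> of the \<open>d\<^sup>2\<close> collisions between the runs are the single event \<open>w\<^sub>i = 0\<close>. The total is
  \<open>(d\<^sup>2 - (m + 1) + 1 + m)/N\<close>.

  If \<open>n = N\<close>, the indices wrap around. Adding a random jump \<open>\<tau>\<close> to the group elements beyond a
  random hyperplane removes this effect, at a cost of \<open>1/N\<close> for each pair of queries that
  overlaps or wraps around.\<close>

subsection \<open>Families of independent uniform answers\<close>

text \<open>Independence and uniformity in one formula, stated through finite sets of prescribed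
  values. In this form the property passes to products and to injective reindexings, and pools over
  different sample spaces become comparable.\<close>

definition uniform_answers :: "'a set \<Rightarrow> 'w pmf \<Rightarrow> ('w \<Rightarrow> 'u \<Rightarrow> 'a) \<Rightarrow> 'u set \<Rightarrow> bool" where
  "uniform_answers L M val D \<longleftrightarrow>
     (\<forall>S g. finite S \<and> S \<subseteq> D \<and> g ` S \<subseteq> L \<longrightarrow>
        measure_pmf.prob M {\<omega>. \<forall>u\<in>S. val \<omega> u = g u} = (1 / real (card L)) ^ card S)"

lemma labels_nonempty: "labels b \<noteq> {}"
  using replicate_in_labels by blast

text \<open>Prescribing the values on \<open>S\<close> leaves exactly the positions in
  \<open>D - S\<close> free, so the matching strings are counted by a power of
  \<open>card (labels b)\<close>.\<close>

lemma uniform_answers_uniform_string: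
  assumes "finite D"
  shows "uniform_answers (labels b) (uniform_string D b) (\<lambda>x. x) D"
  unfolding uniform_answers_def
proof (intro allI impI)
  fix S :: "'a set" and g
  assume S: "finite S \<and> S \<subseteq> D \<and> g ` S \<subseteq> labels b"
  let ?P = "D \<rightarrow>\<^sub>E labels b" and ?c = "card (labels b)"
  have fin: "finite ?P"
    using assms finite_labels by (intro finite_PiE) auto
  have ne: "?P \<noteq> {}"
    using labels_nonempty by (auto simp: PiE_eq_empty_iff)
  have c: "?c > 0"
    using finite_labels labels_nonempty by (simp add: card_gt_0_iff)
  have "?P \<inter> {x. \<forall>u\<in>S. x u = g u} = (\<Pi>\<^sub>E u\<in>D. if u \<in> S then {g u} else labels b)"
    using S by (fastforce simp: PiE_iff extensional_def split: if_splits)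
  then have "card (?P \<inter> {x. \<forall>u\<in>S. x u = g u}) = (\<Prod>u\<in>D. if u \<in> S then 1 else ?c)"
    using assms by (simp add: card_PiE if_distrib cong: if_cong)
  also have "\<dots> = ?c ^ card (D - S)"
    using assms by (simp add: prod.If_cases Diff_eq)
  finally have *: "card (?P \<inter> {x. \<forall>u\<in>S. x u = g u}) = ?c ^ card (D - S)" .
  have "card D = card (D - S) + card S"
    using S assms by (metis card_Diff_subset card_mono le_add_diff_inverse2)
  then have "real (?c ^ card (D - S)) / real (card ?P) = (1 / real ?c) ^ card S"
    using assms c by (simp add: card_PiE power_add power_divide)
  then show "measure_pmf.prob (uniform_string D b) {\<omega>. \<forall>u\<in>S. \<omega> u = g u}
      = (1 / real ?c) ^ card S"
    using fin ne * by (simp add: uniform_string_def measure_pmf_of_set)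
qed

section \<open>Products and reindexings of families of answers\<close>

lemma prob_pair_pmf_Times:
  "measure_pmf.prob (pair_pmf M N) (A \<times> B) = measure_pmf.prob M A * measure_pmf.prob N B"
proof -
  have "emeasure (pair_pmf M N) (A \<times> B)
      = (\<integral>\<^sup>+ x. \<integral>\<^sup>+ y. indicator A x * indicator B y \<partial>measure_pmf N \<partial>measure_pmf M)"
    by (simp add: pair_pmf_def indicator_times)
  also have "\<dots> = emeasure M A * emeasure N B"
    by (simp add: nn_integral_cmult nn_integral_multc)
  finally show ?thesis
    by (simp add: measure_def enn2real_mult)
qed

lemma uniform_answers_pair:
  assumes "uniform_answers L M1 val1 D1" and "uniform_answers L M2 val2 D2"
  shows "uniform_answers L (pair_pmf M1 M2)
           (\<lambda>\<omega>. case_sum (val1 (fst \<omega>)) (val2 (snd \<omega>))) (D1 <+> D2)"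
  unfolding uniform_answers_def
proof (intro allI impI)
  fix S :: "('c + 'e) set" and g
  assume S: "finite S \<and> S \<subseteq> D1 <+> D2 \<and> g ` S \<subseteq> L"
  let ?S1 = "Inl -` S" and ?S2 = "Inr -` S"
  have fin: "finite ?S1" "finite ?S2"
    using S by (auto intro: finite_vimageI)
  have ball_Plus: "(\<forall>u\<in>A <+> B. P u) \<longleftrightarrow> (\<forall>a\<in>A. P (Inl a)) \<and> (\<forall>b\<in>B. P (Inr b))"
    for A :: "'c set" and B :: "'e set" and P
    by (auto simp: Plus_def)
  have split: "S = ?S1 <+> ?S2"
  proof (rule set_eqI)
    fix u show "u \<in> S \<longleftrightarrow> u \<in> ?S1 <+> ?S2"
      by (cases u) auto
  qed
  have "{\<omega>. \<forall>u\<in>S. case_sum (val1 (fst \<omega>)) (val2 (snd \<omega>)) u = g u}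
      = {\<omega>. \<forall>u\<in>?S1. val1 \<omega> u = (g \<circ> Inl) u} \<times> {\<omega>. \<forall>u\<in>?S2. val2 \<omega> u = (g \<circ> Inr) u}"
    by (subst (1) split) (auto simp: ball_Plus)
  moreover have "measure_pmf.prob M1 {\<omega>. \<forall>u\<in>?S1. val1 \<omega> u = (g \<circ> Inl) u}
      = (1 / real (card L)) ^ card ?S1"
  proof -
    have "?S1 \<subseteq> D1" "(g \<circ> Inl) ` ?S1 \<subseteq> L" using S by auto
    then show ?thesis using assms(1) fin unfolding uniform_answers_def by blast
  qed
  moreover have "measure_pmf.prob M2 {\<omega>. \<forall>u\<in>?S2. val2 \<omega> u = (g \<circ> Inr) u}
      = (1 / real (card L)) ^ card ?S2"
  proof -
    have "?S2 \<subseteq> D2" "(g \<circ> Inr) ` ?S2 \<subseteq> L" using S by auto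
    then show ?thesis using assms(2) fin unfolding uniform_answers_def by blast
  qed
  moreover have "card S = card ?S1 + card ?S2"
    using fin by (subst split) (rule card_Plus)
  ultimately show "measure_pmf.prob (pair_pmf M1 M2)
        {\<omega>. \<forall>u\<in>S. case_sum (val1 (fst \<omega>)) (val2 (snd \<omega>)) u = g u}
      = (1 / real (card L)) ^ card S"
    by (simp add: prob_pair_pmf_Times power_add)
qed

text \<open>A prescription is transported along the inverse of \<open>\<phi>\<close> on
  \<open>S\<close>. Injectivity keeps different indices on different entries, so no independence is
  lost.\<close>

lemma uniform_answers_reindex:
  assumes "uniform_answers L M val D" and inj: "inj_on \<phi> D'" and "\<phi> ` D' \<subseteq> D"
  shows "uniform_answers L M (\<lambda>\<omega> u. val \<omega> (\<phi> u)) D'"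
  unfolding uniform_answers_def
proof (intro allI impI)
  fix S :: "'d set" and g
  assume S: "finite S \<and> S \<subseteq> D' \<and> g ` S \<subseteq> L"
  let ?g = "g \<circ> the_inv_into S \<phi>"
  have injS: "inj_on \<phi> S"
    using S inj inj_on_subset by blast
  have g: "?g (\<phi> u) = g u" if "u \<in> S" for u
    using injS that by (simp add: the_inv_into_f_f)
  have "finite (\<phi> ` S)" "\<phi> ` S \<subseteq> D" "?g ` \<phi> ` S \<subseteq> L"
    using S assms(3) g by auto
  then have "measure_pmf.prob M {\<omega>. \<forall>u\<in>\<phi> ` S. val \<omega> u = ?g u}
      = (1 / real (card L)) ^ card (\<phi> ` S)"
    using assms(1) unfolding uniform_answers_def by blast
  then show "measure_pmf.prob M {\<omega>. \<forall>u\<in>S. val \<omega> (\<phi> u) = g u} = (1 / real (card L)) ^ card S"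
    using g injS by (simp add: card_image)
qed

section \<open>Probabilities of lists of constraints\<close>

lemma card_image_le_card_image:
  assumes "finite A" and "\<And>x y. x \<in> A \<Longrightarrow> y \<in> A \<Longrightarrow> g x = g y \<Longrightarrow> f x = f y"
  shows "card (f ` A) \<le> card (g ` A)"
proof -
  have "f ` A \<subseteq> (\<lambda>v. f (SOME x. x \<in> A \<and> g x = v)) ` g ` A"
  proof
    fix v assume "v \<in> f ` A"
    then obtain x where x: "x \<in> A" "v = f x" by blast
    have "(SOME y. y \<in> A \<and> g y = g x) \<in> A \<and> g (SOME y. y \<in> A \<and> g y = g x) = g x"
      by (rule someI[of _ x]) (use x in simp)
    then have "f (SOME y. y \<in> A \<and> g y = g x) = f x"
      using assms(2) x by blast
    then show "v \<in> (\<lambda>v. f (SOME x. x \<in> A \<and> g x = v)) ` g ` A"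
      using x by (intro image_eqI[of _ _ "g x"]) auto
  qed
  then show ?thesis
    using assms(1) by (meson card_image_le card_mono finite_imageI le_trans)
qed

text \<open>Several constraints may name the same variable. When they agree, they amount to one
  prescription per variable, so the exponent counts distinct variables and not constraints.\<close>

lemma prob_answers:
  assumes M: "uniform_answers L M val D" and I: "finite I" "var ` I \<subseteq> D" "lab ` I \<subseteq> L"
    and well: "\<And>u u'. u \<in> I \<Longrightarrow> u' \<in> I \<Longrightarrow> var u = var u' \<Longrightarrow> lab u = lab u'"
  shows "measure_pmf.prob M {\<omega>. \<forall>u\<in>I. val \<omega> (var u) = lab u} = (1 / real (card L)) ^ card (var ` I)"
proof -
  define g where "g = (\<lambda>v. lab (SOME u. u \<in> I \<and> var u = v))"
  have g: "g (var u) = lab u" if "u \<in> I" for u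
  proof -
    have "(SOME u'. u' \<in> I \<and> var u' = var u) \<in> I \<and> var (SOME u'. u' \<in> I \<and> var u' = var u) = var u"
      by (rule someI[of _ u]) (use that in simp)
    then show ?thesis
      unfolding g_def using well that by blast
  qed
  have "{\<omega>. \<forall>u\<in>I. val \<omega> (var u) = lab u} = {\<omega>. \<forall>v\<in>var ` I. val \<omega> v = g v}"
    using g by auto
  moreover have "finite (var ` I) \<and> var ` I \<subseteq> D \<and> g ` var ` I \<subseteq> L"
    using I g by auto
  then have "measure_pmf.prob M {\<omega>. \<forall>v\<in>var ` I. val \<omega> v = g v} = (1 / real (card L)) ^ card (var ` I)"
    using M unfolding uniform_answers_def by blast
  ultimately show ?thesis
    by simp
qed

text \<open>Fewer distinct variables mean fewer independent constraints, hence a larger probability.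
  By \<open>eq12\<close> the second family identifies at least as much as the first; by
  \<open>eq21\<close> a further identification only joins constraints with equal labels and so
  creates no contradiction.\<close>

lemma prob_answers_le:
  assumes M1: "uniform_answers L M1 val1 D1" and M2: "uniform_answers L M2 val2 D2"
    and L: "finite L" "L \<noteq> {}" and I: "finite I" "var1 ` I \<subseteq> D1" "var2 ` I \<subseteq> D2" "lab ` I \<subseteq> L"
    and eq12: "\<And>u u'. u \<in> I \<Longrightarrow> u' \<in> I \<Longrightarrow> var1 u = var1 u' \<Longrightarrow> var2 u = var2 u'"
    and eq21: "\<And>u u'. u \<in> I \<Longrightarrow> u' \<in> I \<Longrightarrow> var2 u = var2 u' \<Longrightarrow> var1 u = var1 u' \<or> lab u = lab u'"
  shows "measure_pmf.prob M1 {\<omega>. \<forall>u\<in>I. val1 \<omega> (var1 u) = lab u}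
       \<le> measure_pmf.prob M2 {\<omega>. \<forall>u\<in>I. val2 \<omega> (var2 u) = lab u}"
proof (cases "\<forall>u\<in>I. \<forall>u'\<in>I. var1 u = var1 u' \<longrightarrow> lab u = lab u'")
  \<comment> \<open>Contradictory constraints in the first family: its event is empty.\<close>
  case False
  then obtain u u' where "u \<in> I" "u' \<in> I" "var1 u = var1 u'" "lab u \<noteq> lab u'"
    by blast
  then have "{\<omega>. \<forall>u\<in>I. val1 \<omega> (var1 u) = lab u} = {}"
    by (metis (mono_tags, lifting) Collect_empty_eq)
  then show ?thesis
    by (simp only: measure_empty measure_nonneg)
next
  case True
  have p1: "measure_pmf.prob M1 {\<omega>. \<forall>u\<in>I. val1 \<omega> (var1 u) = lab u} = (1 / real (card L)) ^ card (var1 ` I)"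
    using I(1,2,4) by (rule prob_answers[OF M1]) (use True in blast)
  have p2: "measure_pmf.prob M2 {\<omega>. \<forall>u\<in>I. val2 \<omega> (var2 u) = lab u} = (1 / real (card L)) ^ card (var2 ` I)"
    using I(1,3,4) by (rule prob_answers[OF M2]) (use True eq21 in blast)
  have "card (var2 ` I) \<le> card (var1 ` I)"
    using I(1) eq12 by (rule card_image_le_card_image)
  moreover have "card L > 0"
    using L by (simp add: card_gt_0_iff)
  ultimately show ?thesis
    unfolding p1 p2 by (intro power_decreasing) auto
qed

subsection \<open>Transcripts of decision trees\<close>

text \<open>A run reads its answers from a pool \<open>V\<close> of values; \<open>r h q\<close> is the entry of
  the pool that answers the query \<open>q\<close> after the history \<open>h\<close>.\<close>

primrec run :: "(('q \<times> 'a) list \<Rightarrow> 'q \<Rightarrow> 'u) \<Rightarrow> ('u \<Rightarrow> 'a) \<Rightarrow> ('q, 'a, 'o) qtree \<Rightarrow> ('q \<times> 'a) list \<Rightarrow> 'o"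
where
  "run r V (Return z) h = z"
| "run r V (Query q f) h = run r V (f (V (r h q))) (h @ [(q, V (r h q))])"

primrec paths :: "'a set \<Rightarrow> ('q, 'a, 'o) qtree \<Rightarrow> (('q \<times> 'a) list \<times> 'o) set" where
  "paths L (Return z) = {([], z)}"
| "paths L (Query q f) = (\<Union>a\<in>L. (\<lambda>(h, z). ((q, a) # h, z)) ` paths L (f a))"

text \<open>\<open>h0\<close> is the history consumed before \<open>h\<close> starts. It is carried
  along because \<open>r\<close> looks at the whole history, so an induction over the tree has to
  start from an arbitrary one.\<close>

definition follows ::
    "(('q \<times> 'a) list \<Rightarrow> 'q \<Rightarrow> 'u) \<Rightarrow> ('u \<Rightarrow> 'a) \<Rightarrow> ('q \<times> 'a) list \<Rightarrow> ('q \<times> 'a) list \<Rightarrow> bool" where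
  "follows r V h0 h \<longleftrightarrow> (\<forall>j<length h. V (r (h0 @ take j h) (fst (h ! j))) = snd (h ! j))"

lemma follows_Nil [simp]: "follows r V h0 []"
  by (simp add: follows_def)

lemma follows_Cons [simp]:
  "follows r V h0 ((q, a) # h) \<longleftrightarrow> V (r h0 q) = a \<and> follows r V (h0 @ [(q, a)]) h"
  by (simp add: follows_def All_less_Suc2)

lemma finite_paths: "finite L \<Longrightarrow> finite (paths L t)"
  by (induction t) auto

lemma run_eq_of_follows:
  "(h, z) \<in> paths L t \<Longrightarrow> follows r V h0 h \<Longrightarrow> run r V t h0 = z"
  by (induction t arbitrary: h h0) auto

lemma ex_path_follows:
  assumes "\<And>h q. q \<in> queries L t \<Longrightarrow> V (r h q) \<in> L"
  shows "\<exists>h. (h, run r V t h0) \<in> paths L t \<and> follows r V h0 h"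
  using assms
proof (induction t arbitrary: h0)
  case (Query q f)
  let ?a = "V (r h0 q)"
  have a: "?a \<in> L"
    using Query.prems by simp
  have "V (r h q') \<in> L" if "q' \<in> queries L (f ?a)" for h q'
    using that a Query.prems[of q' h] by auto
  then have "\<exists>h. (h, run r V (f ?a) (h0 @ [(q, ?a)])) \<in> paths L (f ?a) \<and> follows r V (h0 @ [(q, ?a)]) h"
    by (intro Query.IH) auto
  then obtain h where
    h: "(h, run r V (f ?a) (h0 @ [(q, ?a)])) \<in> paths L (f ?a)" "follows r V (h0 @ [(q, ?a)]) h"
    by blast
  have "((q, ?a) # h, run r V (Query q f) h0) \<in> paths L (Query q f)"
    using a h(1) by (force simp: image_iff)
  moreover have "follows r V h0 ((q, ?a) # h)"
    using h(2) by simp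
  ultimately show ?case by blast
qed simp

text \<open>The pool fixes every answer along the way, so from a given history only one branch is
  consistent with it.\<close>

lemma paths_follows_unique:
  "(h, z) \<in> paths L t \<Longrightarrow> (h', z') \<in> paths L t \<Longrightarrow> follows r V h0 h \<Longrightarrow> follows r V h0 h'
     \<Longrightarrow> h = h' \<and> z = z'"
proof (induction t arbitrary: h h' h0)
  case (Query q f)
  from Query.prems(1) obtain a k where k: "h = (q, a) # k" "(k, z) \<in> paths L (f a)"
    by auto
  from Query.prems(2) obtain a' k' where k': "h' = (q, a') # k'" "(k', z') \<in> paths L (f a')"
    by auto
  have "a = V (r h0 q)" "follows r V (h0 @ [(q, a)]) k"
    using Query.prems(3) k(1) by simp_all
  moreover have "a' = V (r h0 q)" "follows r V (h0 @ [(q, a')]) k'"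
    using Query.prems(4) k'(1) by simp_all
  ultimately show ?case
    using Query.IH[OF rangeI, of k _ k'] k k' by blast
qed simp

text \<open>The next query is determined by the answers so far. Hence two paths of one tree can
  separate only at an answer, and different outputs force such a separation.\<close>

lemma paths_first_difference:
  "(h, z) \<in> paths L t \<Longrightarrow> (h', z') \<in> paths L t \<Longrightarrow> z \<noteq> z' \<Longrightarrow>
     \<exists>m<length h. m < length h' \<and> take m h = take m h' \<and>
        fst (h ! m) = fst (h' ! m) \<and> snd (h ! m) \<noteq> snd (h' ! m)"
proof (induction t arbitrary: h h')
  case (Query q f)
  from Query.prems obtain a k a' k' where
    k: "a \<in> L" "h = (q, a) # k" "(k, z) \<in> paths L (f a)" and
    k': "a' \<in> L" "h' = (q, a') # k'" "(k', z') \<in> paths L (f a')"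
    by auto
  show ?case
  proof (cases "a = a'")
    case True
    then obtain m where "m < length k" "m < length k'" "take m k = take m k'"
        "fst (k ! m) = fst (k' ! m)" "snd (k ! m) \<noteq> snd (k' ! m)"
      using Query.IH[OF rangeI k(3) _ Query.prems(3)] k'(3) by blast
    then show ?thesis
      using k(2) k'(2) True by (intro exI[of _ "Suc m"]) simp
  next
    case False
    then show ?thesis
      using k(2) k'(2) by (intro exI[of _ 0]) simp
  qed
qed simp

lemma paths_length: "(h, z) \<in> paths L t \<Longrightarrow> at_most_queries L t d \<Longrightarrow> length h \<le> d"
proof (induction t arbitrary: h d)
  case (Query q f)
  then obtain a k where k: "a \<in> L" "h = (q, a) # k" "(k, z) \<in> paths L (f a)"
    by auto
  then have "length k \<le> d - 1" "d > 0"
    using Query.IH[OF rangeI k(3)] Query.prems(2) by auto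
  then show ?case
    using k(2) by simp
qed simp

lemma paths_queries: "(h, z) \<in> paths L t \<Longrightarrow> fst ` set h \<subseteq> queries L t"
  by (induction t arbitrary: h) (fastforce)+

lemma paths_answers: "(h, z) \<in> paths L t \<Longrightarrow> snd ` set h \<subseteq> L"
  by (induction t arbitrary: h) (fastforce)+

lemma at_most_queries_mono:
  "at_most_queries L t d \<Longrightarrow> d \<le> d' \<Longrightarrow> at_most_queries L t d'"
proof (induction t arbitrary: d d')
  case (Query q f)
  then show ?case
    by (auto intro: Query.IH[OF rangeI, of _ "d - 1"])
qed simp

subsection \<open>Suppressing repeated queries\<close>

text \<open>Under the collision rule of the reduction, an index asked twice would find its own cell
  in the history and receive a coin instead of its first answer. Answering repetitions from the
  history \<open>h\<close> prevents this and makes the indices on each path distinct.\<close>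

primrec memo :: "('q, 'a, 'o) qtree \<Rightarrow> ('q \<times> 'a) list \<Rightarrow> ('q, 'a, 'o) qtree" where
  "memo (Return z) h = Return z"
| "memo (Query q f) h = (case map_of h q of
      Some a \<Rightarrow> memo (f a) h
    | None \<Rightarrow> Query q (\<lambda>a. memo (f a) (h @ [(q, a)])))"

lemma map_of_in_snd_image: "map_of h q = Some a \<Longrightarrow> snd ` set h \<subseteq> L \<Longrightarrow> a \<in> L"
  by (drule map_of_SomeD) force

lemma at_most_queries_memo:
  "snd ` set h \<subseteq> L \<Longrightarrow> at_most_queries L t d \<Longrightarrow> at_most_queries L (memo t h) d"
proof (induction t arbitrary: h d)
  case (Query q f)
  show ?case
  proof (cases "map_of h q")
    case None
    have "at_most_queries L (memo (f a) (h @ [(q, a)])) (d - 1)" if "a \<in> L" for a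
      using Query.prems that by (intro Query.IH) auto
    then show ?thesis
      using None Query.prems(2) by simp
  next
    case (Some a)
    then have "a \<in> L"
      using Query.prems(1) by (rule map_of_in_snd_image)
    then have "at_most_queries L (f a) d"
      using Query.prems(2) by (auto intro: at_most_queries_mono[of L _ "d - 1"])
    then show ?thesis
      using Some Query.prems(1) by (auto intro: Query.IH)
  qed
qed simp

lemma queries_memo: "snd ` set h \<subseteq> L \<Longrightarrow> queries L (memo t h) \<subseteq> queries L t"
proof (induction t arbitrary: h)
  case (Query q f)
  show ?case
  proof (cases "map_of h q")
    case None
    have "queries L (memo (f a) (h @ [(q, a)])) \<subseteq> queries L (f a)" if "a \<in> L" for a
      using Query.prems that by (intro Query.IH) auto
    then show ?thesis
      using None by fastforce
  next
    case (Some a)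
    then have a: "a \<in> L"
      using Query.prems by (rule map_of_in_snd_image)
    have "queries L (memo (f a) h) \<subseteq> queries L (f a)"
      using Query.prems by (intro Query.IH) auto
    then show ?thesis
      using Some a by auto
  qed
qed simp

lemma memo_paths_distinct:
  "(k, z) \<in> paths L (memo t h) \<Longrightarrow> distinct (map fst k) \<and> fst ` set k \<inter> fst ` set h = {}"
proof (induction t arbitrary: h k)
  case (Query q f)
  show ?case
  proof (cases "map_of h q")
    case None
    then obtain a k' where k': "a \<in> L" "k = (q, a) # k'" "(k', z) \<in> paths L (memo (f a) (h @ [(q, a)]))"
      using Query.prems by auto
    have "q \<notin> fst ` set h"
      using None by (simp add: map_of_eq_None_iff)
    moreover have "distinct (map fst k') \<and> fst ` set k' \<inter> fst ` set (h @ [(q, a)]) = {}"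
      using Query.IH[OF rangeI k'(3)] .
    ultimately show ?thesis
      using k'(2) by auto
  next
    case (Some a)
    then have "(k, z) \<in> paths L (memo (f a) h)"
      using Query.prems by simp
    then show ?thesis
      by (rule Query.IH[OF rangeI])
  qed
qed simp

text \<open>The reading rule \<open>r\<close> ignores the history here, so a recorded answer is what
  a second query would have returned. This connects the original hash function with the
  repetition-free tree in the ideal experiment.\<close>

lemma run_memo_eq_eval:
  assumes "\<And>q. q \<in> queries L t \<Longrightarrow> ora q = V (r q) \<and> ora q \<in> L"
    and "\<And>q a. map_of h q = Some a \<Longrightarrow> a = V (r q)"
    and "snd ` set h \<subseteq> L"
  shows "run (\<lambda>h. r) V (memo t h) h = eval_tree t ora"
  using assms
proof (induction t arbitrary: h)
  case (Query q f)
  have q: "ora q = V (r q)" "V (r q) \<in> L"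
    using Query.prems(1)[of q] by auto
  have sub: "ora q' = V (r q') \<and> ora q' \<in> L" if "q' \<in> queries L (f (V (r q)))" for q'
    using that q(2) Query.prems(1)[of q'] by auto
  show ?case
  proof (cases "map_of h q")
    case None
    have "a = V (r q')" if "map_of (h @ [(q, V (r q))]) q' = Some a" for q' a
      using that Query.prems(2)[of q'] by (auto simp: map_add_def split: option.splits if_splits)
    then have "run (\<lambda>h. r) V (memo (f (V (r q))) (h @ [(q, V (r q))])) (h @ [(q, V (r q))])
        = eval_tree (f (V (r q))) ora"
      using Query.prems(3) q(2) by (intro Query.IH sub rangeI) auto
    then show ?thesis
      using None q by simp
  next
    case (Some a)
    then have "a = V (r q)"
      by (rule Query.prems(2))
    then show ?thesis
      using Some q Query.IH[OF rangeI sub Query.prems(2,3)] by simp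
  qed
qed simp

subsection \<open>Comparing the transcripts of two shifted runs\<close>

text \<open>The entry that the reduction reads when a base point \<open>v\<close> is hidden: a label of the group, or,
  if a different index has led to the same cell before, the coin belonging to the answers so far.\<close>

definition cell_entry ::
    "nat \<Rightarrow> ('q \<Rightarrow> int) \<Rightarrow> int \<Rightarrow> ('q \<times> 'a) list \<Rightarrow> 'q \<Rightarrow> int + 'a list" where
  "cell_entry N c v h q =
     (if c q \<in> c ` fst ` set h then Inr (map snd h) else Inl ((v + c q) mod int N))"

text \<open>Within one run no entry is read twice: a group label is read only on the first visit to
  its cell, and the length of a coin's key reveals the step at which it is read.\<close>

lemma cell_entry_inj:
  assumes c: "\<And>q. c q \<in> {0..<int N}" and a: "a < length h" "a' < length h"
    and eq: "cell_entry N c v (take a h) (fst (h ! a)) = cell_entry N c v (take a' h) (fst (h ! a'))"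
  shows "a = a'"
proof -
  have mod: "c q = c q'" if "(v + c q) mod int N = (v + c q') mod int N" for q q'
  proof -
    have "(c q + v) mod int N = (c q' + v) mod int N"
      using that by (simp add: add.commute)
    then have "c q mod int N = c q' mod int N"
      by (simp add: mod_eq_dvd_iff)
    then show ?thesis
      using c[of q] c[of q'] by simp
  qed
  have less: False if "b < b'" "b' < length h" "c (fst (h ! b)) = c (fst (h ! b'))"
      "c (fst (h ! b')) \<notin> c ` fst ` set (take b' h)" for b b'
  proof -
    have "h ! b \<in> set (take b' h)"
      using that(1,2) by (force simp: in_set_conv_nth)
    then show False
      using that(3,4) by (metis image_eqI)
  qed
  show ?thesis
  proof (cases "c (fst (h ! a)) \<in> c ` fst ` set (take a h)")
    case True
    then have "map snd (take a h) = map snd (take a' h)"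
      using eq by (auto simp: cell_entry_def split: if_splits)
    then have "length (take a h) = length (take a' h)"
      by (metis length_map)
    then show ?thesis
      using a by simp
  next
    case False
    then have *: "c (fst (h ! a')) \<notin> c ` fst ` set (take a' h)" "c (fst (h ! a)) = c (fst (h ! a'))"
      using eq mod by (auto simp: cell_entry_def split: if_splits)
    show ?thesis
      using less[of a a'] less[of a' a] False * a by (metis nat_neq_iff)
  qed
qed

text \<open>The conditions on a key under which the comparison below is exact. \<open>h\<close> and
  \<open>h'\<close> belong to the base points \<open>v\<close> and \<open>v + s\<close>, and
  \<open>m\<close> is their first disagreement. \<open>cross\<close> speaks of different indices
  only, because for equal ones \<open>0 < s < N\<close> already rules out a meeting.\<close>

locale shifted_transcripts =
  fixes N :: nat and c :: "int ^ 'k::finite \<Rightarrow> int" and s v :: int and e :: "int ^ 'k"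
    and h h' :: "((int ^ 'k) \<times> 'a) list" and m :: nat
  assumes cell: "\<And>q. c q \<in> {0..<int N}"
    and s: "0 < s" "s < int N"
    and distinct: "distinct (map fst h)" "distinct (map fst h')"
    and m: "m < length h" "m < length h'" "take m h = take m h'" "fst (h ! m) = fst (h' ! m)"
      "snd (h ! m) \<noteq> snd (h' ! m)"
    and cross: "\<And>a b. a < length h \<Longrightarrow> b < length h' \<Longrightarrow> fst (h ! a) \<noteq> fst (h' ! b) \<Longrightarrow>
      c (fst (h ! a)) = (c (fst (h' ! b)) + s) mod int N \<longleftrightarrow> fst (h ! a) = fst (h' ! b) + e"
    and own: "\<And>l. l < m \<Longrightarrow> c (fst (h ! m)) \<noteq> c (fst (h ! l))"
begin

lemma no_fixed_cell: "c q \<noteq> (c q + s) mod int N"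
proof
  assume "c q = (c q + s) mod int N"
  then have "c q mod int N = (c q + s) mod int N"
    using cell[of q] by simp
  then have "int N dvd s"
    by (simp add: mod_eq_dvd_iff)
  then show False
    using s zdvd_not_zless by blast
qed

lemma nat_entry_eq_iff:
  "(v + c q) mod int N = ((v + s) mod int N + c q') mod int N \<longleftrightarrow> c q = (c q' + s) mod int N"
proof -
  have "((v + s) mod int N + c q') mod int N = (v + (c q' + s)) mod int N"
    by (simp add: mod_simps algebra_simps)
  moreover have "(v + c q) mod int N = (v + (c q' + s)) mod int N
      \<longleftrightarrow> c q mod int N = (c q' + s) mod int N"
    by (simp add: mod_eq_dvd_iff)
  ultimately show ?thesis
    using cell[of q] by simp
qed

text \<open>By \<open>cross\<close> the two cells meet in the group, so it remains to see that
  neither run uses a coin there. An earlier index of the same run in that cell would, again by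
  \<open>cross\<close>, be the same index, contradicting distinctness along the path.\<close>

lemma entries_eq_if_points_eq:
  assumes a: "a < length h" and b: "b < length h'" and eq: "fst (h ! a) = fst (h' ! b) + e"
    and ne: "fst (h ! a) \<noteq> fst (h' ! b)"
  shows "cell_entry N c v (take a h) (fst (h ! a))
       = cell_entry N c ((v + s) mod int N) (take b h') (fst (h' ! b))"
proof -
  have cell_eq: "c (fst (h ! a)) = (c (fst (h' ! b)) + s) mod int N"
    using cross[OF a b ne] eq by simp
  have "c (fst (h ! a)) \<notin> c ` fst ` set (take a h)"
  proof
    assume "c (fst (h ! a)) \<in> c ` fst ` set (take a h)"
    then obtain l where l: "l < a" "c (fst (h ! a)) = c (fst (h ! l))"
      using a by (auto simp: in_set_conv_nth)
    then have l': "c (fst (h ! l)) = (c (fst (h' ! b)) + s) mod int N" "l < length h"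
      using cell_eq a by simp_all
    have "fst (h ! l) \<noteq> fst (h' ! b)"
      using l'(1) no_fixed_cell[of "fst (h' ! b)"] by auto
    then have "fst (h ! l) = fst (h ! a)"
      using cross[OF l'(2) b] l'(1) eq by simp
    then show False
      using distinct(1) a l(1) l'(2) by (auto simp: distinct_conv_nth)
  qed
  moreover have "c (fst (h' ! b)) \<notin> c ` fst ` set (take b h')"
  proof
    assume "c (fst (h' ! b)) \<in> c ` fst ` set (take b h')"
    then obtain l where l: "l < b" "c (fst (h' ! b)) = c (fst (h' ! l))"
      using b by (auto simp: in_set_conv_nth)
    then have l': "c (fst (h ! a)) = (c (fst (h' ! l)) + s) mod int N" "l < length h'"
      using cell_eq b by simp_all
    have "fst (h ! a) \<noteq> fst (h' ! l)"
      using l'(1) no_fixed_cell[of "fst (h' ! l)"] by auto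
    then have "fst (h' ! l) = fst (h' ! b)"
      using cross[OF a l'(2)] l'(1) eq by simp
    then show False
      using distinct(2) b l(1) l'(2) by (auto simp: distinct_conv_nth)
  qed
  ultimately show ?thesis
    using nat_entry_eq_iff[THEN iffD2, OF cell_eq] by (simp add: cell_entry_def)
qed

text \<open>Both runs read the same coin only while their answers agree; the collision found at the first
  disagreement is excluded by \<open>own\<close>.\<close>

lemma points_or_labels_eq_if_entries_eq:
  assumes a: "a < length h" and b: "b < length h'"
    and eq: "cell_entry N c v (take a h) (fst (h ! a))
       = cell_entry N c ((v + s) mod int N) (take b h') (fst (h' ! b))"
  shows "fst (h ! a) = fst (h' ! b) + e \<or> snd (h ! a) = snd (h' ! b)"
proof (cases "c (fst (h ! a)) \<in> c ` fst ` set (take a h)")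
  case False
  then have cell_eq: "c (fst (h ! a)) = (c (fst (h' ! b)) + s) mod int N"
    using eq nat_entry_eq_iff by (auto simp: cell_entry_def split: if_splits)
  then have "fst (h ! a) \<noteq> fst (h' ! b)"
    using no_fixed_cell[of "fst (h' ! b)"] by auto
  then show ?thesis
    using cross[OF a b] cell_eq by simp
next
  case True
  then have hist: "map snd (take a h) = map snd (take b h')"
    using eq by (auto simp: cell_entry_def split: if_splits)
  \<comment> \<open>A coin is keyed by the full list of answers, so a shared coin is read at the
    same step of both runs.\<close>
  then have "length (take a h) = length (take b h')"
    by (metis length_map)
  then have ab: "a = b"
    using a b by simp
  from True obtain l where l: "l < a" "c (fst (h ! a)) = c (fst (h ! l))"
    using a by (auto simp: in_set_conv_nth)
  have "\<not> m < a"
  proof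
    assume "m < a"
    then have "map snd (take a h) ! m = snd (h ! m)" "map snd (take a h') ! m = snd (h' ! m)"
      using m(1,2) a b ab by simp_all
    then show False
      using hist ab m(5) by simp
  qed
  moreover have "a \<noteq> m"
    using own l by blast
  ultimately have "h ! a = h' ! a"
    using m(3) by (metis nat_neq_iff nth_take)
  then show ?thesis
    using ab by simp
qed

text \<open>The steps of both transcripts form one list of constraints, read from two pools. Shared
  points become shared entries, and shared entries come from shared points or carry equal labels, so
  \<open>prob_answers_le\<close> applies. For a key satisfying the locale conditions there is no
  error term: the whole loss lies in the other keys.\<close>

lemma prob_transcripts_le:
  assumes M1: "uniform_answers L M1 val1 D1" and M2: "uniform_answers L M2 val2 D2"
    and L: "finite L" "L \<noteq> {}" and e: "e \<noteq> 0"
    and D1: "\<And>a. a < length h \<Longrightarrow> fst (h ! a) \<in> D1" "\<And>b. b < length h' \<Longrightarrow> fst (h' ! b) + e \<in> D1"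
    and D2: "\<And>a. a < length h \<Longrightarrow> cell_entry N c v (take a h) (fst (h ! a)) \<in> D2"
      "\<And>b. b < length h' \<Longrightarrow> cell_entry N c ((v + s) mod int N) (take b h') (fst (h' ! b)) \<in> D2"
    and labs: "snd ` set h \<subseteq> L" "snd ` set h' \<subseteq> L"
  shows "measure_pmf.prob M1 {\<omega>. follows (\<lambda>_ q. q) (val1 \<omega>) [] h \<and> follows (\<lambda>_ q. q + e) (val1 \<omega>) [] h'}
       \<le> measure_pmf.prob M2 {\<omega>. follows (cell_entry N c v) (val2 \<omega>) [] h \<and>
            follows (cell_entry N c ((v + s) mod int N)) (val2 \<omega>) [] h'}"
proof -
  let ?I = "{..<length h} <+> {..<length h'}"
  define var1 where "var1 = case_sum (\<lambda>a. fst (h ! a)) (\<lambda>b. fst (h' ! b) + e)"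
  define var2 where "var2 = case_sum (\<lambda>a. cell_entry N c v (take a h) (fst (h ! a)))
      (\<lambda>b. cell_entry N c ((v + s) mod int N) (take b h') (fst (h' ! b)))"
  define lab where "lab = case_sum (\<lambda>a. snd (h ! a)) (\<lambda>b. snd (h' ! b))"
  have ball: "(\<forall>u\<in>?I. P u) \<longleftrightarrow> (\<forall>a<length h. P (Inl a)) \<and> (\<forall>b<length h'. P (Inr b))" for P
    by (auto simp: Plus_def)
  have "measure_pmf.prob M1 {\<omega>. \<forall>u\<in>?I. val1 \<omega> (var1 u) = lab u}
      \<le> measure_pmf.prob M2 {\<omega>. \<forall>u\<in>?I. val2 \<omega> (var2 u) = lab u}"
  proof (rule prob_answers_le[OF M1 M2 L])
    show "finite ?I" by simp
    show "var1 ` ?I \<subseteq> D1" "var2 ` ?I \<subseteq> D2"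
      using D1 D2 by (auto simp: var1_def var2_def Plus_def)
    have "snd (h ! a) \<in> L" if "a < length h" for a
      using labs(1) that by (meson imageI nth_mem subsetD)
    moreover have "snd (h' ! b) \<in> L" if "b < length h'" for b
      using labs(2) that by (meson imageI nth_mem subsetD)
    ultimately show "lab ` ?I \<subseteq> L"
      by (auto simp: lab_def Plus_def)
  next
    fix u u' assume u: "u \<in> ?I" "u' \<in> ?I" and eq: "var1 u = var1 u'"
    show "var2 u = var2 u'"
    proof (cases u; cases u')
      fix a a' assume "u = Inl a" "u' = Inl a'"
      then show ?thesis
        using u eq distinct(1) by (auto simp: var1_def distinct_conv_nth)
    next
      fix b b' assume "u = Inr b" "u' = Inr b'"
      then show ?thesis
        using u eq distinct(2) by (auto simp: var1_def distinct_conv_nth)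
    next
      fix a b assume "u = Inl a" "u' = Inr b"
      then show ?thesis
        \<comment> \<open>Since \<open>e\<close> is nonzero, a common point is reached from two
          different indices.\<close>
        using u eq e entries_eq_if_points_eq[of a b] by (auto simp: var1_def var2_def)
    next
      fix a b assume "u = Inr b" "u' = Inl a"
      then show ?thesis
        using u eq[symmetric] e entries_eq_if_points_eq[of a b] by (auto simp: var1_def var2_def)
    qed
  next
    fix u u' assume u: "u \<in> ?I" "u' \<in> ?I" and eq: "var2 u = var2 u'"
    show "var1 u = var1 u' \<or> lab u = lab u'"
    proof (cases u; cases u')
      fix a a' assume *: "u = Inl a" "u' = Inl a'"
      then have "a = a'"
        using u eq by (intro cell_entry_inj[where h = h and v = v, OF cell]) (auto simp: var2_def)
      then show ?thesis using * by simp
    next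
      fix b b' assume *: "u = Inr b" "u' = Inr b'"
      then have "b = b'"
        using u eq by (intro cell_entry_inj[where h = h' and v = "(v + s) mod int N", OF cell]) (auto simp: var2_def)
      then show ?thesis using * by simp
    next
      fix a b assume "u = Inl a" "u' = Inr b"
      then show ?thesis
        using u eq points_or_labels_eq_if_entries_eq[of a b] by (auto simp: var1_def var2_def lab_def)
    next
      fix a b assume "u = Inr b" "u' = Inl a"
      then show ?thesis
        using u eq[symmetric] points_or_labels_eq_if_entries_eq[of a b]
        by (auto simp: var1_def var2_def lab_def)
    qed
  qed
  then show ?thesis
    by (simp only: ball var1_def var2_def lab_def sum.case follows_def append_Nil)
qed

end

subsection \<open>Collisions of cells\<close>

lemma prob_bind_pmf:
  "measure_pmf.prob (bind_pmf M f) A = (\<integral>x. measure_pmf.prob (f x) A \<partial>measure_pmf M)"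
proof -
  have "ennreal (measure_pmf.prob (bind_pmf M f) A) = (\<integral>\<^sup>+ x. ennreal (measure_pmf.prob (f x) A) \<partial>measure_pmf M)"
    by (simp flip: measure_pmf.emeasure_eq_measure)
  also have "\<dots> = ennreal (\<integral>x. measure_pmf.prob (f x) A \<partial>measure_pmf M)"
    by (intro nn_integral_eq_integral measure_pmf.integrable_const_bound[where B = 1]) auto
  finally show ?thesis
    by (simp add: integral_nonneg)
qed

text \<open>Both sides draw the same first stage, so a uniform additive loss survives the averaging
  unchanged.\<close>

lemma prob_bind_pmf_mono:
  assumes "\<And>x. x \<in> set_pmf M \<Longrightarrow> measure_pmf.prob (f x) A \<le> measure_pmf.prob (g x) B + c"
  shows "measure_pmf.prob (bind_pmf M f) A \<le> measure_pmf.prob (bind_pmf M g) B + c"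
proof -
  have int: "integrable (measure_pmf M) (\<lambda>x. measure_pmf.prob (k x) C)" for k :: "'a \<Rightarrow> 'd pmf" and C
    by (intro measure_pmf.integrable_const_bound[where B = 1]) auto
  have "(\<integral>x. measure_pmf.prob (f x) A \<partial>measure_pmf M) \<le> (\<integral>x. measure_pmf.prob (g x) B + c \<partial>measure_pmf M)"
    using assms by (intro integral_mono_AE Bochner_Integration.integrable_add int) (auto simp: AE_measure_pmf_iff)
  also have "\<dots> = (\<integral>x. measure_pmf.prob (g x) B \<partial>measure_pmf M) + c"
    by (simp add: int)
  finally show ?thesis
    by (simp add: prob_bind_pmf)
qed

lemma prob_bind_pmf_le:
  assumes "\<And>x. x \<in> set_pmf M \<Longrightarrow> measure_pmf.prob (f x) A \<le> c"
  shows "measure_pmf.prob (bind_pmf M f) A \<le> c"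
  using prob_bind_pmf_mono[of M f A "\<lambda>_. return_pmf ()" "{}" c] assms by simp

lemma prob_pair_pmf_le_fst:
  assumes "\<And>y. y \<in> set_pmf N \<Longrightarrow> measure_pmf.prob M {x. (x, y) \<in> A} \<le> c"
  shows "measure_pmf.prob (pair_pmf M N) A \<le> c"
proof -
  have "pair_pmf M N = bind_pmf N (\<lambda>y. map_pmf (\<lambda>x. (x, y)) M)"
    unfolding pair_pmf_def map_pmf_def by (rule bind_commute_pmf)
  then show ?thesis
    using assms by (auto intro!: prob_bind_pmf_le simp: vimage_def)
qed

lemma prob_pair_pmf_le_snd:
  assumes "\<And>x. x \<in> set_pmf M \<Longrightarrow> measure_pmf.prob N {y. (x, y) \<in> A} \<le> c"
  shows "measure_pmf.prob (pair_pmf M N) A \<le> c"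
proof -
  have "pair_pmf M N = bind_pmf M (\<lambda>x. map_pmf (\<lambda>y. (x, y)) N)"
    unfolding pair_pmf_def map_pmf_def by simp
  then show ?thesis
    using assms by (auto intro!: prob_bind_pmf_le simp: vimage_def)
qed

text \<open>A solution is determined by its coordinates other than \<open>j\<close>, since the
  coefficient \<open>u $ j\<close> is invertible modulo the prime \<open>N\<close>. Overwriting
  coordinate \<open>j\<close> by an arbitrary residue is therefore injective on solutions times
  residues, so the solutions fill at most a fraction \<open>1 / N\<close> of the box.\<close>

lemma prob_linear_form_le:
  fixes u :: "int ^ 'k::finite"
  assumes N: "prime N" and j: "\<not> int N dvd u $ j"
  shows "measure_pmf.prob (pmf_of_set (box N)) {w. int N dvd (\<Sum>i\<in>UNIV. u $ i * w $ i) + a} \<le> 1 / real N"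
proof -
  define B where "B = {w \<in> box N. int N dvd (\<Sum>i\<in>UNIV. u $ i * w $ i) + a}"
  define f where "f = (\<lambda>(w :: int ^ 'k, t :: int). \<chi> i. if i = j then t else w $ i)"
  have N0: "N > 0"
    using N by (simp add: prime_gt_0_nat)
  have fin: "finite (box N :: (int ^ 'k) set)"
    by (rule finite_box)
  have ne: "(box N :: (int ^ 'k) set) \<noteq> {}"
    using zero_in_box[OF N0] by blast
  have "inj_on f (B \<times> {0..<int N})"
  proof (rule inj_onI)
    fix p p' assume p: "p \<in> B \<times> {0..<int N}" "p' \<in> B \<times> {0..<int N}" and eq: "f p = f p'"
    obtain w t w' t' where p_def: "p = (w, t)" "p' = (w', t')"
      by (cases p, cases p')
    have nth: "(if i = j then t else w $ i) = (if i = j then t' else w' $ i)" for i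
      using arg_cong[OF eq, of "\<lambda>x. x $ i"] by (simp add: f_def p_def)
    have t: "t = t'"
      using nth[of j] by simp
    have other: "w $ i = w' $ i" if "i \<noteq> j" for i
      using nth[of i] that by simp
    have "int N dvd ((\<Sum>i\<in>UNIV. u $ i * w $ i) + a) - ((\<Sum>i\<in>UNIV. u $ i * w' $ i) + a)"
      using p by (intro dvd_diff) (auto simp: p_def B_def)
    also have "\<dots> = (\<Sum>i\<in>UNIV. u $ i * (w $ i - w' $ i))"
      by (simp add: sum_subtractf right_diff_distrib)
    also have "\<dots> = (\<Sum>i\<in>{j}. u $ i * (w $ i - w' $ i))"
      using other by (intro sum.mono_neutral_right) auto
    finally have "int N dvd u $ j * (w $ j - w' $ j)"
      by simp
    then have "int N dvd w $ j - w' $ j"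
      using j N by (simp add: prime_dvd_mult_iff)
    then have "w $ j mod int N = w' $ j mod int N"
      by (simp add: mod_eq_dvd_iff)
    then have "w $ j = w' $ j"
      using p by (auto simp: p_def B_def box_def)
    then have "w = w'"
      using other by (metis vec_eq_iff)
    then show "p = p'"
      using t p_def by simp
  qed
  moreover have "f ` (B \<times> {0..<int N}) \<subseteq> box N"
    by (auto simp: f_def B_def box_def)
  ultimately have "card (B \<times> {0..<int N}) \<le> card (box N :: (int ^ 'k) set)"
    using fin by (rule card_inj_on_le)
  then have "real (card B) * real N \<le> real (card (box N :: (int ^ 'k) set))"
    by (simp add: card_cartesian_product flip: of_nat_mult)
  moreover have "real (card (box N :: (int ^ 'k) set)) > 0"
    using fin ne by (simp add: card_gt_0_iff)
  ultimately have "real (card B) / real (card (box N :: (int ^ 'k) set)) \<le> 1 / real N"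
    using N0 by (simp add: field_simps)
  moreover have "box N \<inter> {w. int N dvd (\<Sum>i\<in>UNIV. u $ i * w $ i) + a} = B"
    by (auto simp: B_def)
  ultimately show ?thesis
    using fin ne by (simp add: measure_pmf_of_set)
qed

section \<open>Random cells and their collisions\<close>

text \<open>The index \<open>\<beta>\<close> is answered by the group element \<open>v + jump_cell N w J \<beta>\<close>. If \<open>n = N\<close>, the plain
  cells \<open>\<Sum>\<^sub>j \<beta>\<^sub>j w\<^sub>j\<close> would wrap around: the indices with
  \<open>\<beta>\<^sub>i = n - 1\<close> of the shifted run would always meet those with \<open>\<beta>\<^sub>i = 0\<close>. A random
  jump at a random hyperplane separates them.\<close>

definition jump_cell :: "nat \<Rightarrow> int ^ 'k::finite \<Rightarrow> int \<times> int \<Rightarrow> int ^ 'k \<Rightarrow> int" where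
  "jump_cell N w J \<beta> =
     ((\<Sum>j\<in>UNIV. \<beta> $ j * w $ j) + snd J * int (card {j. fst J \<le> \<beta> $ j})) mod int N"

text \<open>The first component is the position of the hyperplane, the second the jump. For
  \<open>n = N\<close> the position avoids \<open>0\<close>, so that coordinate \<open>0\<close> is
  always below the hyperplane and coordinate \<open>n - 1\<close> never is. For \<open>n < N\<close>
  the zero jump gives the plain cells.\<close>

definition jumps :: "nat \<Rightarrow> nat \<Rightarrow> (int \<times> int) pmf" where
  "jumps n N = (if n < N then return_pmf (0, 0)
     else pair_pmf (pmf_of_set {1..<int n}) (pmf_of_set {0..<int N}))"

definition keys :: "nat \<Rightarrow> nat \<Rightarrow> ((int ^ 'k::finite) \<times> (int \<times> int)) pmf" where
  "keys n N = pair_pmf (pmf_of_set (box N)) (jumps n N)"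

lemma prob_component_zero_le:
  fixes i :: "'k::finite"
  assumes "prime N"
  shows "measure_pmf.prob (keys n N) {(w, J). w $ i = 0} \<le> 1 / real N"
  unfolding keys_def
proof (rule prob_pair_pmf_le_fst)
  fix J
  have "\<not> int N dvd axis i 1 $ i"
    using assms prime_gt_1_nat[of N] by (auto simp: axis_def)
  from prob_linear_form_le[OF assms this, of 0]
  have "measure_pmf.prob (pmf_of_set (box N)) {w :: int ^ 'k. int N dvd w $ i} \<le> 1 / real N"
    by (simp add: axis_def if_distrib[of "\<lambda>x. x * _"] cong: if_cong)
  moreover have "measure_pmf.prob (pmf_of_set (box N)) {w :: int ^ 'k. (w, J) \<in> {(w, J). w $ i = 0}}
      \<le> measure_pmf.prob (pmf_of_set (box N)) {w. int N dvd w $ i}"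
    by (intro measure_pmf.finite_measure_mono) auto
  ultimately show "measure_pmf.prob (pmf_of_set (box N)) {w :: int ^ 'k. (w, J) \<in> {(w, J). w $ i = 0}}
      \<le> 1 / real N"
    by linarith
qed

text \<open>Separates the linear form in \<open>w\<close> from the contribution of the jump, so that
  the randomness of either can be used while the other is fixed.\<close>

lemma jump_cell_diff_dvd:
  "jump_cell N w J \<alpha> = (jump_cell N w J \<beta> + w $ i) mod int N \<longleftrightarrow>
   int N dvd (\<Sum>j\<in>UNIV. (\<alpha> - (\<beta> + unit_vec i)) $ j * w $ j)
     + snd J * (int (card {j. fst J \<le> \<alpha> $ j}) - int (card {j. fst J \<le> \<beta> $ j}))"
proof -
  have "(\<Sum>j\<in>UNIV. (\<alpha> - (\<beta> + unit_vec i)) $ j * w $ j)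
      = (\<Sum>j\<in>UNIV. \<alpha> $ j * w $ j - \<beta> $ j * w $ j - (if j = i then w $ j else 0))"
    by (intro sum.cong) (auto simp: axis_def algebra_simps)
  also have "\<dots> = (\<Sum>j\<in>UNIV. \<alpha> $ j * w $ j) - (\<Sum>j\<in>UNIV. \<beta> $ j * w $ j) - w $ i"
    by (simp add: sum_subtractf)
  finally have *: "(\<Sum>j\<in>UNIV. (\<alpha> - (\<beta> + unit_vec i)) $ j * w $ j)
      = (\<Sum>j\<in>UNIV. \<alpha> $ j * w $ j) - (\<Sum>j\<in>UNIV. \<beta> $ j * w $ j) - w $ i" .
  show ?thesis
    unfolding * jump_cell_def mod_add_left_eq mod_eq_dvd_iff by (simp add: algebra_simps)
qed

lemma jump_cell_eq_dvd:
  "jump_cell N w J \<alpha> = jump_cell N w J \<beta> \<longleftrightarrow>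
   int N dvd (\<Sum>j\<in>UNIV. (\<alpha> - \<beta>) $ j * w $ j)
     + snd J * (int (card {j. fst J \<le> \<alpha> $ j}) - int (card {j. fst J \<le> \<beta> $ j}))"
proof -
  have "(\<Sum>j\<in>UNIV. (\<alpha> - \<beta>) $ j * w $ j) = (\<Sum>j\<in>UNIV. \<alpha> $ j * w $ j) - (\<Sum>j\<in>UNIV. \<beta> $ j * w $ j)"
    by (simp add: sum_subtractf left_diff_distrib)
  then show ?thesis
    unfolding jump_cell_def mod_eq_dvd_iff by (simp only:) (simp add: algebra_simps)
qed

text \<open>Coordinates on which both indices agree contribute equally, so only coordinate
  \<open>i\<close> can change the number of jumps taken.\<close>

lemma card_threshold_diff:
  fixes \<alpha> \<beta> :: "int ^ 'k::finite"
  assumes "\<And>j. j \<noteq> i \<Longrightarrow> \<alpha> $ j = \<beta> $ j"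
  shows "int (card {j. s \<le> \<alpha> $ j}) - int (card {j. s \<le> \<beta> $ j})
    = of_bool (s \<le> \<alpha> $ i) - of_bool (s \<le> \<beta> $ i)"
proof -
  have card: "int (card {j. s \<le> \<gamma> $ j}) = (\<Sum>j\<in>UNIV. of_bool (s \<le> \<gamma> $ j))" for \<gamma> :: "int ^ 'k"
    by (simp add: of_bool_def sum.If_cases)
  have "(\<Sum>j\<in>UNIV. of_bool (s \<le> \<alpha> $ j) - of_bool (s \<le> \<beta> $ j))
      = (\<Sum>j\<in>{i}. of_bool (s \<le> \<alpha> $ j) - of_bool (s \<le> \<beta> $ j) :: int)"
    using assms by (intro sum.mono_neutral_right) auto
  then show ?thesis
    unfolding card by (simp add: sum_subtractf)
qed

lemma prob_cell_collision_le:
  fixes \<alpha> \<beta> :: "int ^ 'k::finite"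
  assumes N: "prime N" "n \<le> N" and box: "\<alpha> \<in> box n" "\<beta> \<in> box n" and ne: "\<alpha> \<noteq> \<beta>"
  shows "measure_pmf.prob (keys n N) {(w, J). jump_cell N w J \<alpha> = jump_cell N w J \<beta>} \<le> 1 / real N"
  unfolding keys_def
proof (rule prob_pair_pmf_le_fst)
  fix J
  obtain j where j: "\<alpha> $ j \<noteq> \<beta> $ j"
    using ne by (metis vec_eq_iff)
  \<comment> \<open>A nonzero difference of coordinates is smaller than \<open>N\<close> in absolute
    value, hence a coefficient not divisible by \<open>N\<close>, whatever the jump is.\<close>
  have "\<bar>\<alpha> $ j - \<beta> $ j\<bar> < int N"
    using box N(2) by (auto simp: box_def abs_if dest!: spec[of _ j])
  then have "\<not> int N dvd (\<alpha> - \<beta>) $ j"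
    using j dvd_imp_le_int[of "\<alpha> $ j - \<beta> $ j" "int N"] by auto
  from prob_linear_form_le[OF N(1) this]
  show "measure_pmf.prob (pmf_of_set (box N)) {w. (w, J) \<in> {(w, J). jump_cell N w J \<alpha> = jump_cell N w J \<beta>}}
      \<le> 1 / real N"
    by (simp add: jump_cell_eq_dvd)
qed

text \<open>Three cases for the offset \<open>\<alpha> - (\<beta> + unit_vec i)\<close>. If it is
  nonzero modulo \<open>N\<close>, the basis makes a meeting unlikely. If it is zero, the cells meet
  unless a nonzero jump falls exactly between the indices. If it is nonzero but zero modulo
  \<open>N\<close>, the indices wrap around, and only a zero jump lets the cells meet.\<close>

lemma prob_cell_mismatch_le:
  fixes \<alpha> \<beta> :: "int ^ 'k::finite"
  assumes N: "prime N" "n \<le> N" and box: "\<alpha> \<in> box n" "\<beta> \<in> box n"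
  shows "measure_pmf.prob (keys n N)
    {(w, J). (jump_cell N w J \<alpha> = (jump_cell N w J \<beta> + w $ i) mod int N) \<noteq> (\<alpha> = \<beta> + unit_vec i)} \<le> 1 / real N"
    (is "measure_pmf.prob _ ?E \<le> _")
proof -
  have N1: "N > 1"
    using N(1) by (rule prime_gt_1_nat)
  have b: "0 \<le> \<alpha> $ j" "\<alpha> $ j < int n" "0 \<le> \<beta> $ j" "\<beta> $ j < int n" for j
    using box by (auto simp: box_def)
  let ?u = "\<alpha> - (\<beta> + unit_vec i)"
  consider (linear) j where "\<not> int N dvd ?u $ j" | (shift) "\<alpha> = \<beta> + unit_vec i"
    | (seam) "\<alpha> \<noteq> \<beta> + unit_vec i" "\<And>j. int N dvd ?u $ j"
    by blast
  then show ?thesis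
  proof cases
    case linear
    then have ne: "\<alpha> \<noteq> \<beta> + unit_vec i"
      by auto
    show ?thesis
      unfolding keys_def
    proof (rule prob_pair_pmf_le_fst)
      fix J
      show "measure_pmf.prob (pmf_of_set (box N)) {w. (w, J) \<in> ?E} \<le> 1 / real N"
        using prob_linear_form_le[OF N(1) linear] ne by (simp add: jump_cell_diff_dvd)
    qed
  next
    case shift
    have E: "(w, J) \<in> ?E \<longleftrightarrow> \<not> int N dvd snd J * of_bool (fst J = \<alpha> $ i)" for w J
    proof -
      have "int (card {j. fst J \<le> \<alpha> $ j}) - int (card {j. fst J \<le> \<beta> $ j})
          = of_bool (fst J \<le> \<alpha> $ i) - of_bool (fst J \<le> \<beta> $ i)"
        using shift by (intro card_threshold_diff) (simp add: axis_def)
      also have "\<dots> = of_bool (fst J = \<alpha> $ i)"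
        using shift by (simp add: axis_def)
      finally show ?thesis
        using shift by (simp add: jump_cell_diff_dvd del: of_bool_eq_iff)
    qed
    show ?thesis
    proof (cases "n < N")
      case True
      show ?thesis
        unfolding keys_def by (rule prob_pair_pmf_le_fst) (use True E in \<open>auto simp: jumps_def\<close>)
    next
      case False
      then have n: "n = N"
        using N(2) by simp
      show ?thesis
        unfolding keys_def
      proof (rule prob_pair_pmf_le_snd)
        fix w
        have "measure_pmf.prob (jumps n N) {J. (w, J) \<in> ?E} \<le> measure_pmf.prob (jumps n N) ({\<alpha> $ i} \<times> - {0})"
          unfolding E by (intro measure_pmf.finite_measure_mono) auto
        \<comment> \<open>The hyperplane hits \<open>\<alpha> $ i\<close> with probability at most
          \<open>1 / (N - 1)\<close> and the jump is nonzero with probability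
          \<open>(N - 1) / N\<close>; the product is at most \<open>1 / N\<close>.\<close>
        also have "\<dots> = real (card ({1..<int N} \<inter> {\<alpha> $ i})) / (real N - 1) * (real (card ({0..<int N} \<inter> - {0})) / real N)"
          using N1 by (simp add: jumps_def n prob_pair_pmf_Times measure_pmf_of_set of_nat_diff)
        also have "card ({0..<int N} \<inter> - {0}) = N - 1"
        proof -
          have "{0..<int N} \<inter> - {0} = {1..<int N}"
            by auto
          then show ?thesis by simp
        qed
        also have "real (card ({1..<int N} \<inter> {\<alpha> $ i})) / (real N - 1) * (real (N - 1) / real N)
            \<le> 1 / (real N - 1) * (real (N - 1) / real N)"
          using N1 card_mono[of "{\<alpha> $ i}" "{1..<int N} \<inter> {\<alpha> $ i}"]
          by (intro mult_right_mono divide_right_mono) auto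
        also have "\<dots> = 1 / real N"
          using N1 by (simp add: of_nat_diff)
        finally show "measure_pmf.prob (jumps n N) {J. (w, J) \<in> ?E} \<le> 1 / real N" .
      qed
    qed
  next
    case seam
    have off: "\<alpha> $ j = \<beta> $ j" if "j \<noteq> i" for j
    proof (rule ccontr)
      assume "\<alpha> $ j \<noteq> \<beta> $ j"
      moreover have "int N dvd \<alpha> $ j - \<beta> $ j"
        using seam(2)[of j] that by (simp add: axis_def)
      ultimately have "int N \<le> \<bar>\<alpha> $ j - \<beta> $ j\<bar>"
        using dvd_imp_le_int[of "\<alpha> $ j - \<beta> $ j" "int N"] by simp
      then show False
        using b[of j] N(2) by (simp add: abs_if split: if_splits)
    qed
    have "\<alpha> $ i \<noteq> \<beta> $ i + 1"
    proof
      assume *: "\<alpha> $ i = \<beta> $ i + 1"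
      have "\<alpha> $ j = (\<beta> + unit_vec i) $ j" for j
        using off[of j] * by (cases "j = i") (simp_all add: axis_def)
      then show False
        using seam(1) by (simp add: vec_eq_iff)
    qed
    moreover have "int N dvd \<alpha> $ i - \<beta> $ i - 1"
      using seam(2)[of i] by (simp add: axis_def algebra_simps)
    ultimately have "int N \<le> \<bar>\<alpha> $ i - \<beta> $ i - 1\<bar>"
      using dvd_imp_le_int[of "\<alpha> $ i - \<beta> $ i - 1" "int N"] by simp
    \<comment> \<open>The number \<open>\<alpha> $ i - \<beta> $ i - 1\<close> lies between
      \<open>- n\<close> and \<open>n - 2\<close>. Its absolute value reaches \<open>N\<close> only
      at the lower end, and only for \<open>n = N\<close>.\<close>
    then have ends: "n = N" "\<alpha> $ i = 0" "\<beta> $ i = int N - 1"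
      using b[of i] N(2) by (simp_all add: abs_if split: if_splits)
    show ?thesis
      unfolding keys_def
    proof (rule prob_pair_pmf_le_snd)
      fix w
      have "J \<in> UNIV \<times> {0}" if J: "J \<in> set_pmf (jumps n N)" and E: "(w, J) \<in> ?E" for J
      proof -
        have J': "1 \<le> fst J" "fst J < int N" "0 \<le> snd J" "snd J < int N"
          using J N1 ends(1) by (auto simp: jumps_def)
        have "int (card {j. fst J \<le> \<alpha> $ j}) - int (card {j. fst J \<le> \<beta> $ j})
            = of_bool (fst J \<le> \<alpha> $ i) - of_bool (fst J \<le> \<beta> $ i)"
          using off by (rule card_threshold_diff)
        \<comment> \<open>Every admissible hyperplane separates coordinate \<open>0\<close> from
          coordinate \<open>N - 1\<close>.\<close>
        also have "\<dots> = - 1"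
          using J' ends by simp
        finally have card: "int (card {j. fst J \<le> \<alpha> $ j}) - int (card {j. fst J \<le> \<beta> $ j}) = - 1" .
        have "int N dvd (\<Sum>j\<in>UNIV. ?u $ j * w $ j) - snd J"
          using E seam(1) unfolding mem_Collect_eq prod.case jump_cell_diff_dvd card by simp
        moreover have "int N dvd (\<Sum>j\<in>UNIV. ?u $ j * w $ j)"
          using seam(2) by (intro dvd_sum dvd_mult2)
        ultimately have "int N dvd snd J"
          by (metis dvd_diff_right_iff)
        then have "snd J = 0"
          using J' by (auto dest: zdvd_imp_le)
        then show ?thesis
          by (cases J) simp
      qed
      then have "measure_pmf.prob (jumps n N) {J. (w, J) \<in> ?E} \<le> measure_pmf.prob (jumps n N) (UNIV \<times> {0})"
        by (intro measure_pmf.finite_measure_mono_AE) (auto simp: AE_measure_pmf_iff)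
      also have "\<dots> = real (card ({0..<int N} \<inter> {0})) / real N"
        using N1 by (simp add: jumps_def ends(1) prob_pair_pmf_Times measure_pmf_of_set)
      also have "\<dots> \<le> 1 / real N"
        using card_mono[of "{0}" "{0..<int N} \<inter> {0}"] by (intro divide_right_mono) auto
      finally show "measure_pmf.prob (jumps n N) {J. (w, J) \<in> ?E} \<le> 1 / real N" .
    qed
  qed
qed

subsection \<open>The reduction\<close>

text \<open>\<open>as\<close> lists all answers given to the hash function, repetitions included, as
  its next-step function expects; \<open>h\<close> records first-time queries only and decides about
  cells and coins. The counter bounds the remaining hash queries. The output \<open>0\<close> is a
  default that is not reached when the hash function respects its query bound.\<close>

primrec simulator ::
    "('q \<Rightarrow> int) \<Rightarrow> ('q \<Rightarrow> 'g) \<Rightarrow> ('a list \<Rightarrow> 'a) \<Rightarrow> nat \<Rightarrow> 'a list \<Rightarrow> ('q \<times> 'a) list \<Rightarrow>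
       ('g, 'q, 'a, 'o::zero) prog" where
  "simulator c \<psi> G 0 as h = Ask_Hash as (case_sum (\<lambda>_. Output 0) Output)"
| "simulator c \<psi> G (Suc m) as h = Ask_Hash as (case_sum
     (\<lambda>q. case map_of h q of
         Some a \<Rightarrow> simulator c \<psi> G m (as @ [a]) h
       | None \<Rightarrow>
           if c q \<in> c ` fst ` set h
           then simulator c \<psi> G m (as @ [G (map snd h)]) (h @ [(q, G (map snd h))])
           else Ask_Group (\<psi> q) (\<lambda>a. simulator c \<psi> G m (as @ [a]) (h @ [(q, a)])))
     Output)"

lemma at_most_queries_simulator: "at_most_queries L (link (simulator c \<psi> G m as h) t) m"
proof (induction m arbitrary: as h)
  case 0
  then show ?case by (auto split: sum.split)
next
  case (Suc m)
  have "at_most_queries L (link (simulator c \<psi> G m as h) t) (Suc m)" for as h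
    by (rule at_most_queries_mono[OF Suc]) simp
  then show ?case
    using Suc by (auto split: sum.split option.split)
qed

lemma queries_simulator: "queries L (link (simulator c \<psi> G m as h) t) \<subseteq> range \<psi>"
proof (induction m arbitrary: as h)
  case 0
  then show ?case by (auto split: sum.split)
next
  case (Suc m)
  then show ?case
    by (auto split: sum.split option.split)
qed

text \<open>Invariant: \<open>t'\<close> is what remains of \<open>t\<close> after the answers
  \<open>as\<close>, expressed through next steps because this is all the program sees. The bound
  \<open>length h + m \<le> d\<close> keeps the key of every coin shorter than \<open>d\<close>,
  where \<open>G\<close> yields legal labels.\<close>

lemma eval_link_simulator:
  assumes t: "\<And>bs. next_step t (as @ bs) = next_step t' bs"
    and "at_most_queries L t' m" and "queries L t' \<subseteq> B" and "snd ` set h \<subseteq> L" and "length h + m \<le> d"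
    and ora: "\<And>q. q \<in> B \<Longrightarrow> ora (\<psi> q) = X ((v + c q) mod int N) \<and> ora (\<psi> q) \<in> L"
    and G: "\<And>hs. set hs \<subseteq> L \<Longrightarrow> length hs < d \<Longrightarrow> G hs \<in> L"
  shows "eval_tree (link (simulator c \<psi> G m as h) t) ora
       = run (cell_entry N c v) (case_sum X G) (memo t' h) h"
  using assms(1-5)
proof (induction m arbitrary: as h t')
  case 0
  have "next_step t as = next_step t' []"
    using 0(1)[of "[]"] by simp
  then show ?case
    using 0(2) by (cases t') auto
next
  case (Suc m)
  have step: "next_step t as = next_step t' []"
    using Suc.prems(1)[of "[]"] by simp
  show ?case
  proof (cases t')
    case (Return z)
    then show ?thesis using step by simp
  next
    case (Query q f)
    have next_f: "next_step t ((as @ [a]) @ bs) = next_step (f a) bs" for a bs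
      using Suc.prems(1)[of "a # bs"] Query by simp
    have f: "at_most_queries L (f a) m" "queries L (f a) \<subseteq> B" if "a \<in> L" for a
      using Suc.prems(2,3) Query that by auto
    have q: "q \<in> B"
      using Suc.prems(3) Query by auto
    show ?thesis
    proof (cases "map_of h q")
      case (Some a)
      then have "a \<in> L"
        using Suc.prems(4) by (rule map_of_in_snd_image)
      then show ?thesis
        using Some step Query Suc.prems(4,5) Suc.IH[OF next_f f, of a h] by simp
    next
      case None
      define a where "a = case_sum X G (cell_entry N c v h q)"
      have aL: "a \<in> L"
        using ora[OF q] G[of "map snd h"] Suc.prems(4,5) by (auto simp: a_def cell_entry_def)
      have "eval_tree (link (simulator c \<psi> G (Suc m) as h) t) ora
          = eval_tree (link (simulator c \<psi> G m (as @ [a]) (h @ [(q, a)])) t) ora"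
        using None step Query ora[OF q] by (auto simp: a_def cell_entry_def)
      also have "\<dots> = run (cell_entry N c v) (case_sum X G) (memo (f a) (h @ [(q, a)])) (h @ [(q, a)])"
        using aL Suc.prems(4,5) by (intro Suc.IH next_f f) auto
      also have "\<dots> = run (cell_entry N c v) (case_sum X G) (memo t' h) h"
        using None Query by (simp add: a_def)
      finally show ?thesis .
    qed
  qed
qed

text \<open>A restricted query cannot add the jump directly, so the jumped cell is rewritten as a
  combination of the basis with coefficients in \<open>box n\<close>. Any such combination will do,
  since the oracle depends only on its value; the default \<open>0\<close> keeps the query legal
  when there is none.\<close>

definition cell_query :: "nat \<Rightarrow> nat \<Rightarrow> int ^ 'k::finite \<Rightarrow> int \<Rightarrow> int \<times> (int ^ 'k)" where
  "cell_query n N w x =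
     (1, if \<exists>\<rho>\<in>box n. (\<Sum>j\<in>UNIV. \<rho> $ j * w $ j) mod int N = x
         then SOME \<rho>. \<rho> \<in> box n \<and> (\<Sum>j\<in>UNIV. \<rho> $ j * w $ j) mod int N = x
         else 0)"

lemma cell_query_in: "n > 0 \<Longrightarrow> cell_query n N w x \<in> {1} \<times> box n"
  unfolding cell_query_def
  using someI_ex[of "\<lambda>\<rho>. \<rho> \<in> box n \<and> (\<Sum>j\<in>UNIV. \<rho> $ j * w $ j) mod int N = x"] zero_in_box[of n]
  by auto

text \<open>For \<open>n < N\<close> there is no jump and the index itself serves. For
  \<open>n = N\<close> a nonzero \<open>w $ i\<close> is invertible modulo \<open>N\<close>, and its
  multiples by coefficients below \<open>n\<close> reach every residue.\<close>

lemma ex_cell_query: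
  assumes N: "prime N" "n \<le> N" and w: "w \<in> box N" "w $ i \<noteq> 0" and J: "J \<in> set_pmf (jumps n N)"
    and \<beta>: "\<beta> \<in> box n"
  shows "\<exists>\<rho>\<in>box n. (\<Sum>j\<in>UNIV. \<rho> $ j * w $ j) mod int N = jump_cell N w J \<beta>"
proof (cases "n < N")
  case True
  then show ?thesis
    using J \<beta> by (auto simp: jumps_def jump_cell_def)
next
  case False
  then have n: "n = N"
    using N(2) by simp
  define x where "x = jump_cell N w J \<beta>"
  have N0: "int N > 0"
    using N(1) by (simp add: prime_gt_0_nat)
  have x: "x mod int N = x"
    by (simp add: x_def jump_cell_def)
  have "\<not> int N dvd w $ i"
    using w by (auto simp: box_def dest!: zdvd_imp_le spec[of _ i])
  then have "gcd (w $ i) (int N) = 1"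
    using N(1) by (metis coprime_iff_gcd_eq_1 coprime_commute prime_imp_coprime prime_nat_int_transfer)
  then obtain u y where uy: "u * w $ i + y * int N = 1"
    using bezout_int[of "w $ i" "int N"] by auto
  define \<rho> where "\<rho> = axis i ((x * u) mod int N)"
  have "\<rho> \<in> box n"
    using N0 by (auto simp: \<rho>_def box_def axis_def n)
  moreover have "(\<Sum>j\<in>UNIV. \<rho> $ j * w $ j) = (x * u) mod int N * w $ i"
    by (simp add: \<rho>_def axis_def if_distrib[of "\<lambda>x. x * _"] cong: if_cong)
  moreover have "(x * u) mod int N * w $ i mod int N = x"
  proof -
    have "(x * u) mod int N * w $ i mod int N = x * (u * w $ i) mod int N"
      by (simp add: mod_mult_left_eq mult.assoc)
    also have "x * (u * w $ i) = x + int N * (- x * y)"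
    proof -
      have "x * (u * w $ i) = x * (u * w $ i + y * int N) - x * y * int N"
        by (simp add: algebra_simps)
      then show ?thesis
        unfolding uy by simp
    qed
    finally show ?thesis
      using x by (simp only: mod_mult_self2)
  qed
  ultimately show ?thesis
    unfolding x_def by (intro bexI[of _ \<rho>]) simp_all
qed

lemma group_oracle_cell_query:
  assumes "prime N" "n \<le> N" "w \<in> box N" "w $ i \<noteq> 0" "J \<in> set_pmf (jumps n N)" "\<beta> \<in> box n"
  shows "group_oracle N X w v (cell_query n N w (jump_cell N w J \<beta>)) = X ((v + jump_cell N w J \<beta>) mod int N)"
proof -
  let ?P = "\<lambda>\<rho>. \<rho> \<in> box n \<and> (\<Sum>j\<in>UNIV. \<rho> $ j * w $ j) mod int N = jump_cell N w J \<beta>"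
  have ex: "\<exists>\<rho>. ?P \<rho>"
    using ex_cell_query[OF assms] by blast
  obtain \<rho> where \<rho>: "\<rho> = (SOME \<rho>. ?P \<rho>)"
    by blast
  have P: "?P \<rho>"
    unfolding \<rho> using ex by (rule someI_ex)
  have "cell_query n N w (jump_cell N w J \<beta>) = (1, \<rho>)"
    using ex by (auto simp: cell_query_def \<rho>)
  then have "group_oracle N X w v (cell_query n N w (jump_cell N w J \<beta>))
      = X ((v + (\<Sum>j\<in>UNIV. \<rho> $ j * w $ j)) mod int N)"
    by (simp add: group_oracle_def)
  then show ?thesis
    using P by (metis mod_add_right_eq)
qed

definition histories :: "nat \<Rightarrow> nat \<Rightarrow> label list set" where
  "histories b d = {hs. set hs \<subseteq> labels b \<and> length hs < d}"

lemma finite_histories: "finite (histories b d)"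
  by (rule finite_subset[OF _ finite_lists_length_le[OF finite_labels, of b d]])
     (auto simp: histories_def)

text \<open>\<open>J\<close> and \<open>G\<close> are drawn together with the program, so both
  executions share them.\<close>

definition lphs_reduction :: "nat \<Rightarrow> nat \<Rightarrow> nat \<Rightarrow> nat \<Rightarrow> 'k::finite reduction" where
  "lphs_reduction n N b d w = map_pmf
     (\<lambda>(J, G). simulator (jump_cell N w J) (\<lambda>\<beta>. cell_query n N w (jump_cell N w J \<beta>)) G d [] [])
     (pair_pmf (jumps n N) (uniform_string (histories b d) b))"

subsection \<open>The loss of the reduction\<close>

text \<open>Union bound over keys with \<open>w $ i = 0\<close>, mismatches between the runs, and
  collisions with step \<open>m\<close>. Although \<open>m\<close> varies with the transcripts, it
  cancels: the \<open>m + 1\<close> diagonal pairs missing from \<open>P\<close> pay for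
  \<open>Zero\<close> and for the \<open>m\<close> events \<open>Own\<close>.\<close>

lemma ex_bad_keys:
  fixes h h' :: "((int ^ 'k::finite) \<times> 'a) list"
  assumes N: "prime N" "n \<le> N"
    and distinct: "distinct (map fst h)" "distinct (map fst h')"
    and box: "fst ` set h \<subseteq> box n" "fst ` set h' \<subseteq> box n"
    and len: "length h \<le> d" "length h' \<le> d"
    and m: "m < length h" "m < length h'" "take m h = take m h'" "fst (h ! m) = fst (h' ! m)"
      "snd (h ! m) \<noteq> snd (h' ! m)"
  shows "\<exists>Bad. measure_pmf.prob (keys n N) Bad \<le> (real d)\<^sup>2 / real N \<and>
    (\<forall>(w, J)\<in>set_pmf (keys n N) - Bad.
       shifted_transcripts N (jump_cell N w J) (w $ i) (unit_vec i) h h' m)"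
proof -
  have N0: "N > 0"
    using N(1) by (rule prime_gt_0_nat)
  have in_box: "fst (h ! a) \<in> box n" if "a < length h" for a
    using box(1) that by (meson imageI nth_mem subsetD)
  have in_box': "fst (h' ! b) \<in> box n" if "b < length h'" for b
    using box(2) that by (meson imageI nth_mem subsetD)
  define P where "P = {(a, b). a < length h \<and> b < length h' \<and> fst (h ! a) \<noteq> fst (h' ! b)}"
  define Zero where "Zero = {(w :: int ^ 'k, J :: int \<times> int). w $ i = 0}"
  define Cross where "Cross = (\<lambda>(a, b). {(w, J).
    (jump_cell N w J (fst (h ! a)) = (jump_cell N w J (fst (h' ! b)) + w $ i) mod int N)
      \<noteq> (fst (h ! a) = fst (h' ! b) + unit_vec i)})"
  define Own where "Own = (\<lambda>l. {(w, J). jump_cell N w J (fst (h ! m)) = jump_cell N w J (fst (h ! l))})"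
  define Bad where "Bad = Zero \<union> (\<Union>p\<in>P. Cross p) \<union> (\<Union>l<m. Own l)"
  have eq: "fst (h ! j) = fst (h' ! j)" if "j \<le> m" for j
  proof (cases "j = m")
    case False
    then show ?thesis
      using that m(3) by (metis le_neq_implies_less nth_take)
  qed (use m in simp)
  let ?diag = "(\<lambda>j. (j, j)) ` {..m}"
  \<comment> \<open>Up to and including step \<open>m\<close> both transcripts ask the same
    index.\<close>
  have P_sub: "P \<subseteq> {..<length h} \<times> {..<length h'} - ?diag"
    using eq by (auto simp: P_def)
  have fin_P: "finite P"
    by (rule finite_subset[OF P_sub]) simp
  have "card P \<le> card ({..<length h} \<times> {..<length h'} - ?diag)"
    using P_sub by (intro card_mono) auto
  also have "\<dots> = card ({..<length h} \<times> {..<length h'}) - card ?diag"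
    using m(1,2) by (intro card_Diff_subset) auto
  also have "\<dots> = length h * length h' - Suc m"
    by (simp add: card_cartesian_product card_image inj_on_def)
  finally have "card P \<le> length h * length h' - Suc m" .
  \<comment> \<open>Makes the truncated subtraction above a true one.\<close>
  moreover have "Suc m * 1 \<le> length h * length h'"
    using m(1,2) by (intro mult_le_mono) auto
  ultimately have "1 + card P + m \<le> length h * length h'"
    by (simp add: le_diff_conv2)
  also have "\<dots> \<le> d * d"
    using len by (intro mult_le_mono)
  finally have "1 + card P + m \<le> d * d" .
  then have card: "1 + real (card P) + real m \<le> (real d)\<^sup>2"
    by (simp add: power2_eq_square flip: of_nat_mult of_nat_add of_nat_Suc)
  let ?pr = "measure_pmf.prob (keys n N :: ((int ^ 'k) \<times> (int \<times> int)) pmf)"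
  have "?pr Bad \<le> ?pr (Zero \<union> (\<Union>p\<in>P. Cross p)) + ?pr (\<Union>l<m. Own l)"
    unfolding Bad_def by (rule measure_Un_le) auto
  also have "?pr (Zero \<union> (\<Union>p\<in>P. Cross p)) \<le> ?pr Zero + ?pr (\<Union>p\<in>P. Cross p)"
    by (rule measure_Un_le) auto
  also have "?pr Zero \<le> 1 / real N"
    unfolding Zero_def by (rule prob_component_zero_le[OF N(1)])
  also have "?pr (\<Union>p\<in>P. Cross p) \<le> (\<Sum>p\<in>P. ?pr (Cross p))"
    using fin_P by (intro measure_pmf.finite_measure_subadditive_finite) auto
  also have "\<dots> \<le> (\<Sum>p\<in>P. 1 / real N)"
  proof (rule sum_mono)
    fix p assume "p \<in> P"
    then show "?pr (Cross p) \<le> 1 / real N"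
      using prob_cell_mismatch_le[OF N in_box in_box'] by (auto simp: P_def Cross_def)
  qed
  also have "?pr (\<Union>l<m. Own l) \<le> (\<Sum>l<m. ?pr (Own l))"
    by (intro measure_pmf.finite_measure_subadditive_finite) auto
  also have "\<dots> \<le> (\<Sum>l<m. 1 / real N)"
  proof (rule sum_mono)
    fix l assume "l \<in> {..<m}"
    then have l: "l < m" "l < length h"
      using m(1) by auto
    then have "fst (h ! m) \<noteq> fst (h ! l)"
      using distinct(1) m(1) by (auto simp: distinct_conv_nth)
    then show "?pr (Own l) \<le> 1 / real N"
      unfolding Own_def using l m(1) by (intro prob_cell_collision_le[OF N] in_box)
  qed
  also have "1 / real N + (\<Sum>p\<in>P. 1 / real N) + (\<Sum>l<m. 1 / real N) = (1 + real (card P) + real m) / real N"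
    by (simp add: add_divide_distrib)
  also have "\<dots> \<le> (real d)\<^sup>2 / real N"
    using card by (intro divide_right_mono) auto
  finally have "?pr Bad \<le> (real d)\<^sup>2 / real N"
    by simp
  moreover have "shifted_transcripts N (jump_cell N w J) (w $ i) (unit_vec i) h h' m"
    if key: "(w, J) \<in> set_pmf (keys n N)" and good: "(w, J) \<notin> Bad" for w J
  proof
    have "set_pmf (pmf_of_set (box N :: (int ^ 'k) set)) = box N"
      using zero_in_box[OF N0] finite_box by (intro set_pmf_of_set) auto
    then have "w \<in> box N"
      using key by (simp add: keys_def)
    then have "0 \<le> w $ i" "w $ i < int N"
      by (auto simp: box_def)
    moreover have "w $ i \<noteq> 0"
      using good by (simp add: Bad_def Zero_def)
    ultimately show "0 < w $ i" "w $ i < int N"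
      by simp_all
    show "jump_cell N w J q \<in> {0..<int N}" for q
      using N0 by (simp add: jump_cell_def)
    show "(jump_cell N w J (fst (h ! a)) = (jump_cell N w J (fst (h' ! b)) + w $ i) mod int N)
        = (fst (h ! a) = fst (h' ! b) + unit_vec i)"
      if "a < length h" "b < length h'" "fst (h ! a) \<noteq> fst (h' ! b)" for a b
    proof -
      have "(a, b) \<in> P"
        using that by (simp add: P_def)
      then have "(w, J) \<notin> Cross (a, b)"
        using good by (auto simp: Bad_def)
      then show ?thesis
        by (simp add: Cross_def)
    qed
    show "jump_cell N w J (fst (h ! m)) \<noteq> jump_cell N w J (fst (h ! l))" if "l < m" for l
    proof -
      have "(w, J) \<notin> Own l"
        using good that by (auto simp: Bad_def)
      then show ?thesis
        by (simp add: Own_def)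
    qed
  qed (use distinct m in auto)
  ultimately show ?thesis
    by (intro exI[of _ Bad]) auto
qed

section \<open>Decomposition of an experiment by pairs of transcripts\<close>

definition both_follow ::
    "(('q \<times> 'a) list \<Rightarrow> 'q \<Rightarrow> 'u) \<Rightarrow> (('q \<times> 'a) list \<Rightarrow> 'q \<Rightarrow> 'u) \<Rightarrow> ('u \<Rightarrow> 'a) \<Rightarrow>
       (('q \<times> 'a) list \<times> 'o) \<times> (('q \<times> 'a) list \<times> 'o) \<Rightarrow> bool" where
  "both_follow r r' V p \<longleftrightarrow> follows r V [] (fst (fst p)) \<and> follows r' V [] (fst (snd p))"

text \<open>Each value of the pool is consistent with at most one path per run, so the events of
  different pairs are disjoint and the sum is exact.\<close>

lemma prob_Union_both_follow:
  assumes "finite L" and Q: "Q \<subseteq> paths L t \<times> paths L t"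
  shows "measure_pmf.prob M (\<Union>p\<in>Q. {\<omega>. both_follow r r' (val \<omega>) p})
       = (\<Sum>p\<in>Q. measure_pmf.prob M {\<omega>. both_follow r r' (val \<omega>) p})"
proof (rule measure_pmf.finite_measure_finite_Union)
  show "finite Q"
    using finite_paths[OF assms(1)] Q by (meson finite_SigmaI finite_subset)
  show "disjoint_family_on (\<lambda>p. {\<omega>. both_follow r r' (val \<omega>) p}) Q"
  proof (unfold disjoint_family_on_def, intro ballI impI)
    fix p p' assume p: "p \<in> Q" "p' \<in> Q" "p \<noteq> p'"
    obtain h z h' z' where p_eq: "p = ((h, z), (h', z'))"
      by (metis surj_pair)
    obtain k y k' y' where p'_eq: "p' = ((k, y), (k', y'))"
      by (metis surj_pair)
    have in_paths: "(h, z) \<in> paths L t" "(h', z') \<in> paths L t" "(k, y) \<in> paths L t" "(k', y') \<in> paths L t"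
      using p(1,2) Q by (auto simp: p_eq p'_eq)
    have "p = p'" if "both_follow r r' V p" "both_follow r r' V p'" for V
      using that paths_follows_unique[OF in_paths(1,3), of r V "[]"]
        paths_follows_unique[OF in_paths(2,4), of r' V "[]"]
      by (simp add: both_follow_def p_eq p'_eq)
    then show "{\<omega>. both_follow r r' (val \<omega>) p} \<inter> {\<omega>. both_follow r r' (val \<omega>) p'} = {}"
      using p(3) by blast
  qed
qed auto

section \<open>The pool behind the ideal experiment\<close>

definition lphs_pool ::
    "nat \<Rightarrow> nat \<Rightarrow> 'k::finite \<Rightarrow> ((int ^ 'k \<Rightarrow> label) \<times> (int ^ 'k \<Rightarrow> label)) pmf" where
  "lphs_pool n b i = pair_pmf (uniform_string (box n) b) (uniform_string {\<beta> \<in> box n. \<beta> $ i = int n - 1} b)"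

text \<open>The string and its shift are two windows of one uniform string on the box enlarged by
  one layer. The fresh symbols fill that layer and are stored under the indices one step back, as in
  \<open>noncyclic_shift\<close>.\<close>

definition lphs_label ::
    "nat \<Rightarrow> 'k::finite \<Rightarrow> (int ^ 'k \<Rightarrow> label) \<times> (int ^ 'k \<Rightarrow> label) \<Rightarrow> int ^ 'k \<Rightarrow> label" where
  "lphs_label n i \<omega> p = (if p \<in> box n then fst \<omega> p else snd \<omega> (p - unit_vec i))"

lemma shift_in_box_iff:
  assumes "\<beta> \<in> box n"
  shows "\<beta> + unit_vec i \<in> box n \<longleftrightarrow> \<beta> $ i \<noteq> int n - 1"
proof -
  have \<beta>: "0 \<le> \<beta> $ j \<and> \<beta> $ j < int n" for j
    using assms by (simp add: box_def)
  have "(\<beta> + unit_vec i) $ j = (if j = i then \<beta> $ i + 1 else \<beta> $ j)" for j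
    by (simp add: axis_def)
  then have "\<beta> + unit_vec i \<in> box n \<longleftrightarrow> \<beta> $ i + 1 < int n"
    unfolding box_def using \<beta> by (auto simp: add_nonneg_nonneg split: if_splits)
  then show ?thesis
    using \<beta>[of i] by auto
qed

lemma uniform_answers_lphs_pool:
  "uniform_answers (labels b) (lphs_pool n b i) (lphs_label n i)
     (box n \<union> (\<lambda>\<beta>. \<beta> + unit_vec i) ` box n)" (is "uniform_answers _ _ _ ?D")
proof -
  let ?face = "{\<beta> \<in> box n. \<beta> $ i = int n - 1}"
  define \<phi> where "\<phi> = (\<lambda>p. if p \<in> box n then Inl p else Inr (p - unit_vec i) :: int ^ 'a + int ^ 'a)"
  have "uniform_answers (labels b) (lphs_pool n b i)
      (\<lambda>\<omega>. case_sum (fst \<omega>) (snd \<omega>)) (box n <+> ?face)"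
    unfolding lphs_pool_def
    by (intro uniform_answers_pair uniform_answers_uniform_string) (simp_all add: finite_box)
  moreover have "inj_on \<phi> ?D"
    by (rule inj_onI) (auto simp: \<phi>_def split: if_splits)
  moreover have "\<phi> ` ?D \<subseteq> box n <+> ?face"
    using shift_in_box_iff[of _ n i] by (auto simp: \<phi>_def)
  ultimately have "uniform_answers (labels b) (lphs_pool n b i)
      (\<lambda>\<omega> p. case_sum (fst \<omega>) (snd \<omega>) (\<phi> p)) ?D"
    by (rule uniform_answers_reindex)
  moreover have "(\<lambda>\<omega> p. case_sum (fst \<omega>) (snd \<omega>) (\<phi> p)) = lphs_label n i"
    by (auto simp: fun_eq_iff \<phi>_def lphs_label_def)
  ultimately show ?thesis by simp
qed

lemma lphs_label_in_labels:
  assumes "\<omega> \<in> set_pmf (lphs_pool n b i)" and "p \<in> box n \<union> (\<lambda>\<beta>. \<beta> + unit_vec i) ` box n"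
  shows "lphs_label n i \<omega> p \<in> labels b"
proof -
  have "fst \<omega> \<in> box n \<rightarrow>\<^sub>E labels b" "snd \<omega> \<in> {\<beta> \<in> box n. \<beta> $ i = int n - 1} \<rightarrow>\<^sub>E labels b"
    using assms(1) by (auto simp: lphs_pool_def set_pmf_uniform_string finite_box)
  then show ?thesis
    using assms(2) shift_in_box_iff[of _ n i] by (auto simp: lphs_label_def PiE_iff)
qed

text \<open>Over the enlarged string, the run on the shifted input is a run on the same pool that
  reads \<open>q + unit_vec i\<close> in place of \<open>q\<close>.\<close>

lemma lphs_experiment_eq:
  assumes t: "queries (labels b) t \<subseteq> box n"
  shows "do { x \<leftarrow> uniform_string (box n) b;
              x' \<leftarrow> noncyclic_shift n b i x;
              return_pmf (eval_tree t x, eval_tree t x') }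
       = map_pmf (\<lambda>\<omega>. (run (\<lambda>_ q. q) (lphs_label n i \<omega>) (memo t []) [],
                        run (\<lambda>_ q. q + unit_vec i) (lphs_label n i \<omega>) (memo t []) [])) (lphs_pool n b i)"
proof -
  let ?shift = "\<lambda>\<omega>. \<lambda>\<beta>\<in>box n. if \<beta> $ i = int n - 1 then snd \<omega> \<beta> else fst \<omega> (\<beta> + unit_vec i)"
  have "do { x \<leftarrow> uniform_string (box n) b; x' \<leftarrow> noncyclic_shift n b i x;
             return_pmf (eval_tree t x, eval_tree t x') }
      = map_pmf (\<lambda>\<omega>. (eval_tree t (fst \<omega>), eval_tree t (?shift \<omega>))) (lphs_pool n b i)"
    by (simp add: lphs_pool_def noncyclic_shift_def pair_pmf_def map_pmf_def bind_assoc_pmf bind_return_pmf cong: if_cong)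
  also have "\<dots> = map_pmf (\<lambda>\<omega>. (run (\<lambda>_ q. q) (lphs_label n i \<omega>) (memo t []) [],
                        run (\<lambda>_ q. q + unit_vec i) (lphs_label n i \<omega>) (memo t []) [])) (lphs_pool n b i)"
  proof (intro map_pmf_cong refl)
    fix \<omega> assume \<omega>: "\<omega> \<in> set_pmf (lphs_pool n b i)"
    have "run (\<lambda>_ q. q) (lphs_label n i \<omega>) (memo t []) [] = eval_tree t (fst \<omega>)"
    proof (intro run_memo_eq_eval[where L = "labels b"])
      fix q assume "q \<in> queries (labels b) t"
      then have q: "q \<in> box n"
        using t by blast
      then have "fst \<omega> q = lphs_label n i \<omega> q"
        by (simp add: lphs_label_def)
      then show "fst \<omega> q = lphs_label n i \<omega> q \<and> fst \<omega> q \<in> labels b"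
        using lphs_label_in_labels[OF \<omega>] q by simp
    qed auto
    moreover have "run (\<lambda>_ q. q + unit_vec i) (lphs_label n i \<omega>) (memo t []) [] = eval_tree t (?shift \<omega>)"
    proof (intro run_memo_eq_eval[where L = "labels b"])
      fix q assume "q \<in> queries (labels b) t"
      then have q: "q \<in> box n"
        using t by blast
      have "?shift \<omega> q = lphs_label n i \<omega> (q + unit_vec i)"
        using q shift_in_box_iff[OF q, of i] by (simp add: lphs_label_def)
      then show "?shift \<omega> q = lphs_label n i \<omega> (q + unit_vec i) \<and> ?shift \<omega> q \<in> labels b"
        using lphs_label_in_labels[OF \<omega>] q by simp
    qed auto
    ultimately show "(eval_tree t (fst \<omega>), eval_tree t (?shift \<omega>))
        = (run (\<lambda>_ q. q) (lphs_label n i \<omega>) (memo t []) [],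
           run (\<lambda>_ q. q + unit_vec i) (lphs_label n i \<omega>) (memo t []) [])"
      by simp
  qed
  finally show ?thesis .
qed

section \<open>The pool behind the group experiment\<close>

definition group_pool :: "nat \<Rightarrow> nat \<Rightarrow> nat \<Rightarrow> ((int \<Rightarrow> label) \<times> (label list \<Rightarrow> label)) pmf" where
  "group_pool N b d = pair_pmf (uniform_string {0..<int N} b) (uniform_string (histories b d) b)"

lemma uniform_answers_group_pool:
  "uniform_answers (labels b) (group_pool N b d) (\<lambda>\<omega>. case_sum (fst \<omega>) (snd \<omega>))
     ({0..<int N} <+> histories b d)"
  unfolding group_pool_def
  by (intro uniform_answers_pair uniform_answers_uniform_string) (simp_all add: finite_histories)

lemma cell_entry_in_pool:
  assumes "N > 0" and "snd ` set h \<subseteq> labels b" and "a < length h" and "length h \<le> d"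
  shows "cell_entry N c v (take a h) q \<in> {0..<int N} <+> histories b d"
proof -
  have "set (map snd (take a h)) \<subseteq> labels b"
    using assms(2) set_take_subset[of a h] by auto
  then show ?thesis
    using assms by (auto simp: cell_entry_def histories_def)
qed

definition reduced_outputs ::
    "nat \<Rightarrow> nat \<Rightarrow> nat \<Rightarrow> 'k::finite lphs_tree \<Rightarrow> (int ^ 'k) \<times> (int \<times> int) \<Rightarrow> int \<Rightarrow>
       (int \<Rightarrow> label) \<times> (label list \<Rightarrow> label) \<Rightarrow> int ^ 'k" where
  "reduced_outputs n N d t key v \<omega> = (case key of (w, J) \<Rightarrow> case \<omega> of (X, G) \<Rightarrow>
     eval_tree (link (simulator (jump_cell N w J) (\<lambda>\<beta>. cell_query n N w (jump_cell N w J \<beta>)) G d [] []) t)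
       (group_oracle N X w v))"

lemma reduced_outputs_eq_run:
  assumes N: "prime N" "n \<le> N" and t: "at_most_queries (labels b) t d" "queries (labels b) t \<subseteq> box n"
    and key: "(w, J) \<in> set_pmf (keys n N)" "w $ i \<noteq> 0" and \<omega>: "\<omega> \<in> set_pmf (group_pool N b d)"
  shows "reduced_outputs n N d t (w, J) v \<omega>
    = run (cell_entry N (jump_cell N w J) v) (case_sum (fst \<omega>) (snd \<omega>)) (memo t []) []"
proof -
  have N0: "N > 0"
    using N(1) by (rule prime_gt_0_nat)
  have "set_pmf (pmf_of_set (box N :: (int ^ 'a) set)) = box N"
    using zero_in_box[OF N0] finite_box by (intro set_pmf_of_set) auto
  then have w: "w \<in> box N" "J \<in> set_pmf (jumps n N)"
    using key(1) by (simp_all add: keys_def)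
  have X: "fst \<omega> \<in> {0..<int N} \<rightarrow>\<^sub>E labels b" and G: "snd \<omega> \<in> histories b d \<rightarrow>\<^sub>E labels b"
    using \<omega> by (auto simp: group_pool_def set_pmf_uniform_string finite_histories)
  have "eval_tree (link (simulator (jump_cell N w J) (\<lambda>\<beta>. cell_query n N w (jump_cell N w J \<beta>)) (snd \<omega>) d [] []) t)
       (group_oracle N (fst \<omega>) w v)
     = run (cell_entry N (jump_cell N w J) v) (case_sum (fst \<omega>) (snd \<omega>)) (memo t []) []"
  proof (rule eval_link_simulator[where B = "box n" and L = "labels b" and d = d])
    fix q :: "int ^ 'a" assume "q \<in> box n"
    then show "group_oracle N (fst \<omega>) w v (cell_query n N w (jump_cell N w J q))
          = fst \<omega> ((v + jump_cell N w J q) mod int N) \<and>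
        group_oracle N (fst \<omega>) w v (cell_query n N w (jump_cell N w J q)) \<in> labels b"
      using group_oracle_cell_query[OF N w(1) key(2) w(2)] X N0 by (auto simp: PiE_iff)
  next
    fix hs assume "set hs \<subseteq> labels b" "length hs < d"
    then show "snd \<omega> hs \<in> labels b"
      using G by (auto simp: histories_def PiE_iff)
  qed (use t in auto)
  then show ?thesis
    by (simp add: reduced_outputs_def case_prod_beta)
qed

section \<open>Loss for a fixed hash tree and base point\<close>

type_synonym 'k outcome = "((int ^ 'k) \<times> label) list \<times> (int ^ 'k)"

text \<open>For each successful pair of paths, the real probability is at least the ideal one
  outside a set of bad keys depending on that pair. A union over all pairs would be far too large;
  instead each bad set is weighted by the ideal probability of its pair. These weights sum to at
  most \<open>1\<close>, so the average loss stays below the bound for a single pair.\<close>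

lemma reduction_loss:
  fixes t :: "'k::finite lphs_tree" and i :: 'k
  assumes N: "prime N" "n \<le> N" and t: "at_most_queries (labels b) t d" "queries (labels b) t \<subseteq> box n"
  shows "measure_pmf.prob (do { key \<leftarrow> keys n N; \<omega> \<leftarrow> group_pool N b d;
             return_pmf (reduced_outputs n N d t key v \<omega>,
                         reduced_outputs n N d t key ((v + fst key $ i) mod int N) \<omega>) })
           {(z, z'). z - z' \<noteq> unit_vec i}
       \<le> measure_pmf.prob (do { x \<leftarrow> uniform_string (box n) b; x' \<leftarrow> noncyclic_shift n b i x;
             return_pmf (eval_tree t x, eval_tree t x') })
           {(z, z'). z \<noteq> z' + unit_vec i} + (real d)\<^sup>2 / real N"
    (is "measure_pmf.prob ?Real ?fail \<le> measure_pmf.prob ?Ideal ?fail' + ?\<epsilon>")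
proof -
  have N0: "N > 0"
    using N(1) by (rule prime_gt_0_nat)
  define T where "T = memo t []"
  define L where "L = labels b"
  define e :: "int ^ 'k" where "e = unit_vec i"
  have e: "e \<noteq> 0"
    by (simp add: e_def axis_eq_0_iff)
  have L: "finite L" "L \<noteq> {}"
    using finite_labels labels_nonempty by (simp_all add: L_def)
  have T: "at_most_queries L T d" "queries L T \<subseteq> box n"
    using t at_most_queries_memo[of "[]" L t d] queries_memo[of "[]" L t] by (auto simp: T_def L_def)
  \<comment> \<open>Only successful pairs are compared. Their outputs differ, as \<open>e\<close> is
    nonzero, so each pair has a first disagreement.\<close>
  define Z where "Z = {p \<in> paths L T \<times> paths L T. snd (fst p) = snd (snd p) + e}"
  have Z_sub: "Z \<subseteq> paths L T \<times> paths L T"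
    by (auto simp: Z_def)
  have fin_Z: "finite Z"
    by (rule finite_subset[OF Z_sub]) (simp add: finite_paths[OF L(1)])
  define ideal where "ideal = (\<lambda>p :: 'k outcome \<times> 'k outcome. measure_pmf.prob (lphs_pool n b i)
    {\<omega>. both_follow (\<lambda>_ q. q) (\<lambda>_ q. q + e) (lphs_label n i \<omega>) p})"
  define rl where "rl = (\<lambda>w J (p :: 'k outcome \<times> 'k outcome). measure_pmf.prob (group_pool N b d)
    {\<omega>. both_follow (cell_entry N (jump_cell N w J) v)
       (cell_entry N (jump_cell N w J) ((v + w $ i) mod int N)) (case_sum (fst \<omega>) (snd \<omega>)) p})"
  have ideal_nonneg: "ideal p \<ge> 0" for p
    by (simp add: ideal_def)

  have sum_le: "(\<Sum>p\<in>Z. ideal p) \<le> 1"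
    unfolding ideal_def prob_Union_both_follow[OF L(1) Z_sub, symmetric] by simp

  have ideal_le: "1 - measure_pmf.prob ?Ideal ?fail' \<le> (\<Sum>p\<in>Z. ideal p)"
  proof -
    let ?run = "\<lambda>\<omega>. run (\<lambda>_ q. q) (lphs_label n i \<omega>) T []"
    let ?run' = "\<lambda>\<omega>. run (\<lambda>_ q. q + e) (lphs_label n i \<omega>) T []"
    have "?Ideal = map_pmf (\<lambda>\<omega>. (?run \<omega>, ?run' \<omega>)) (lphs_pool n b i)"
      unfolding T_def e_def by (rule lphs_experiment_eq[OF t(2)])
    then have "measure_pmf.prob ?Ideal ?fail'
        = measure_pmf.prob (lphs_pool n b i) {\<omega>. ?run \<omega> \<noteq> ?run' \<omega> + e}"
      by (simp add: vimage_def e_def)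
    also have "1 - \<dots> = measure_pmf.prob (lphs_pool n b i) (UNIV - {\<omega>. ?run \<omega> \<noteq> ?run' \<omega> + e})"
      using measure_pmf.prob_compl[of "{\<omega>. ?run \<omega> \<noteq> ?run' \<omega> + e}" "lphs_pool n b i"] by simp
    also have "\<dots> \<le> measure_pmf.prob (lphs_pool n b i)
        (\<Union>p\<in>Z. {\<omega>. both_follow (\<lambda>_ q. q) (\<lambda>_ q. q + e) (lphs_label n i \<omega>) p})"
    proof (rule measure_pmf.finite_measure_mono_AE)
      have "\<exists>p\<in>Z. both_follow (\<lambda>_ q. q) (\<lambda>_ q. q + e) (lphs_label n i \<omega>) p"
        if \<omega>: "\<omega> \<in> set_pmf (lphs_pool n b i)" and succ: "?run \<omega> = ?run' \<omega> + e" for \<omega>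
      proof -
        have "lphs_label n i \<omega> q \<in> L \<and> lphs_label n i \<omega> (q + e) \<in> L" if "q \<in> queries L T" for q
          using lphs_label_in_labels[OF \<omega>] that T(2) by (auto simp: L_def e_def)
        then obtain h h' where "(h, ?run \<omega>) \<in> paths L T" "follows (\<lambda>_ q. q) (lphs_label n i \<omega>) [] h"
            "(h', ?run' \<omega>) \<in> paths L T" "follows (\<lambda>_ q. q + e) (lphs_label n i \<omega>) [] h'"
          using ex_path_follows[of L T "lphs_label n i \<omega>" "\<lambda>_ q. q" "[]"]
            ex_path_follows[of L T "lphs_label n i \<omega>" "\<lambda>_ q. q + e" "[]"] by blast
        then show ?thesis
          using succ by (intro bexI[of _ "((h, ?run \<omega>), (h', ?run' \<omega>))"]) (auto simp: Z_def both_follow_def)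
      qed
      then show "AE \<omega> in lphs_pool n b i. \<omega> \<in> UNIV - {\<omega>. ?run \<omega> \<noteq> ?run' \<omega> + e} \<longrightarrow>
          \<omega> \<in> (\<Union>p\<in>Z. {\<omega>. both_follow (\<lambda>_ q. q) (\<lambda>_ q. q + e) (lphs_label n i \<omega>) p})"
        by (auto simp: AE_measure_pmf_iff)
    qed simp
    also have "\<dots> = (\<Sum>p\<in>Z. ideal p)"
      unfolding ideal_def by (rule prob_Union_both_follow[OF L(1) Z_sub])
    finally show ?thesis .
  qed

  have "\<exists>Bad. measure_pmf.prob (keys n N) Bad \<le> ?\<epsilon> \<and>
      (\<forall>(w, J)\<in>set_pmf (keys n N) - Bad. w $ i \<noteq> 0 \<and> ideal p \<le> rl w J p)" if p: "p \<in> Z" for p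
  proof -
    obtain h z h' z' where p_eq: "p = ((h, z), (h', z'))"
      by (metis surj_pair)
    have hz: "(h, z) \<in> paths L T" "(h', z') \<in> paths L T" "z = z' + e"
      using p by (auto simp: Z_def p_eq)
    then have "z \<noteq> z'"
      using e by simp
    then obtain m where m: "m < length h" "m < length h'" "take m h = take m h'"
        "fst (h ! m) = fst (h' ! m)" "snd (h ! m) \<noteq> snd (h' ! m)"
      using paths_first_difference[OF hz(1,2)] by blast
    have distinct: "distinct (map fst h)" "distinct (map fst h')"
      using memo_paths_distinct[of _ _ L t "[]"] hz(1,2) unfolding T_def by blast+
    have box: "fst ` set h \<subseteq> box n" "fst ` set h' \<subseteq> box n"
      using paths_queries[OF hz(1)] paths_queries[OF hz(2)] T(2) by auto
    have len: "length h \<le> d" "length h' \<le> d"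
      using paths_length[OF _ T(1)] hz(1,2) by blast+
    have lab: "snd ` set h \<subseteq> L" "snd ` set h' \<subseteq> L"
      using paths_answers[OF hz(1)] paths_answers[OF hz(2)] by auto
    obtain Bad where Bad: "measure_pmf.prob (keys n N) Bad \<le> ?\<epsilon>"
        "\<forall>(w, J)\<in>set_pmf (keys n N) - Bad. shifted_transcripts N (jump_cell N w J) (w $ i) e h h' m"
      using ex_bad_keys[OF N distinct box len m] unfolding e_def by blast
    have "w $ i \<noteq> 0 \<and> ideal p \<le> rl w J p" if "(w, J) \<in> set_pmf (keys n N) - Bad" for w J
    proof -
      interpret shifted_transcripts N "jump_cell N w J" "w $ i" v e h h' m
        using Bad(2) that by blast
      have "ideal p \<le> rl w J p"
        unfolding ideal_def rl_def both_follow_def p_eq fst_conv snd_conv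
        using uniform_answers_lphs_pool[of b n i] uniform_answers_group_pool[of b N d]
      proof (rule prob_transcripts_le[OF _ _ _ _ e])
        show "finite (labels b)" "labels b \<noteq> {}"
          using L by (simp_all add: L_def)
        show "snd ` set h \<subseteq> labels b" "snd ` set h' \<subseteq> labels b"
          using lab by (simp_all add: L_def)
        then show "cell_entry N (jump_cell N w J) v (take a h) (fst (h ! a)) \<in> {0..<int N} <+> histories b d"
            if "a < length h" for a
          using that len(1) N0 by (intro cell_entry_in_pool)
        show "cell_entry N (jump_cell N w J) ((v + w $ i) mod int N) (take a h') (fst (h' ! a))
            \<in> {0..<int N} <+> histories b d" if "a < length h'" for a
          using that len(2) N0 \<open>snd ` set h' \<subseteq> labels b\<close> by (intro cell_entry_in_pool)
        show "fst (h ! a) \<in> box n \<union> (\<lambda>\<beta>. \<beta> + unit_vec i) ` box n" if "a < length h" for a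
          using box(1) that by (meson UnI1 imageI nth_mem subsetD)
        show "fst (h' ! a) + e \<in> box n \<union> (\<lambda>\<beta>. \<beta> + unit_vec i) ` box n" if "a < length h'" for a
          using box(2) that unfolding e_def by (meson UnI2 imageI nth_mem subsetD)
      qed
      then show ?thesis
        using s by simp
    qed
    then show ?thesis
      using Bad(1) by blast
  qed
  then have "\<forall>p\<in>Z. \<exists>Bad. measure_pmf.prob (keys n N) Bad \<le> ?\<epsilon> \<and>
      (\<forall>(w, J)\<in>set_pmf (keys n N) - Bad. w $ i \<noteq> 0 \<and> ideal p \<le> rl w J p)"
    by (intro ballI)
  from bchoice[OF this] obtain Bad where Bad': "\<forall>p\<in>Z. measure_pmf.prob (keys n N) (Bad p) \<le> ?\<epsilon> \<and>
      (\<forall>(w, J)\<in>set_pmf (keys n N) - Bad p. w $ i \<noteq> 0 \<and> ideal p \<le> rl w J p)" ..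
  have Bad: "measure_pmf.prob (keys n N) (Bad p) \<le> ?\<epsilon>"
      "(w, J) \<in> set_pmf (keys n N) \<Longrightarrow> (w, J) \<notin> Bad p \<Longrightarrow> w $ i \<noteq> 0 \<and> ideal p \<le> rl w J p"
    if "p \<in> Z" for p w J
    using bspec[OF Bad' that] by auto

  let ?real = "\<lambda>key. map_pmf (\<lambda>\<omega>. (reduced_outputs n N d t key v \<omega>,
      reduced_outputs n N d t key ((v + fst key $ i) mod int N) \<omega>)) (group_pool N b d)"
  have real_le: "measure_pmf.prob (?real key) ?fail \<le> 1 - (\<Sum>p\<in>Z. ideal p * (1 - indicator (Bad p) key))"
    if key: "key \<in> set_pmf (keys n N)" for key
  proof -
    obtain w J where wJ: "key = (w, J)"
      by (metis surj_pair)
    \<comment> \<open>The pairs for which the given key is good. Their events are disjoint parts of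
      the success event.\<close>
    define Q where "Q = {p \<in> Z. key \<notin> Bad p}"
    have Q_sub: "Q \<subseteq> paths L T \<times> paths L T"
      using Z_sub by (auto simp: Q_def)
    have "(\<Sum>p\<in>Z. ideal p * (1 - indicator (Bad p) key)) = (\<Sum>p\<in>Q. ideal p)"
      unfolding Q_def using fin_Z by (subst sum.inter_filter) (auto intro!: sum.cong simp: indicator_def)
    also have "\<dots> \<le> measure_pmf.prob (?real key) (- ?fail)"
    proof (cases "Q = {}")
      case False
      \<comment> \<open>Any pair with a good key supplies the nonzero component with which every
        cell can be queried.\<close>
      then have wi: "w $ i \<noteq> 0"
        using Bad(2)[of _ w J] key by (auto simp: Q_def wJ)
      let ?val = "\<lambda>\<omega>. case_sum (fst \<omega>) (snd \<omega>) :: int + label list \<Rightarrow> label"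
      let ?r = "cell_entry N (jump_cell N w J) v"
      let ?r' = "cell_entry N (jump_cell N w J) ((v + w $ i) mod int N)"
      have "(\<Sum>p\<in>Q. ideal p) \<le> (\<Sum>p\<in>Q. rl w J p)"
        using Bad(2)[of _ w J] key by (intro sum_mono) (auto simp: Q_def wJ)
      also have "\<dots> = measure_pmf.prob (group_pool N b d) (\<Union>p\<in>Q. {\<omega>. both_follow ?r ?r' (?val \<omega>) p})"
        unfolding rl_def by (rule prob_Union_both_follow[OF L(1) Q_sub, symmetric])
      also have "\<dots> \<le> measure_pmf.prob (group_pool N b d) {\<omega>.
          (reduced_outputs n N d t key v \<omega>, reduced_outputs n N d t key ((v + fst key $ i) mod int N) \<omega>) \<in> - ?fail}"
      proof (rule measure_pmf.finite_measure_mono_AE)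
        have "(reduced_outputs n N d t key v \<omega>, reduced_outputs n N d t key ((v + fst key $ i) mod int N) \<omega>) \<in> - ?fail"
          if \<omega>: "\<omega> \<in> set_pmf (group_pool N b d)" and p: "p \<in> Q" "both_follow ?r ?r' (?val \<omega>) p" for \<omega> p
        proof -
          obtain h z h' z' where p_eq: "p = ((h, z), (h', z'))"
            by (metis surj_pair)
          have hz: "(h, z) \<in> paths L T" "(h', z') \<in> paths L T" "z = z' + e"
            using p(1) by (auto simp: Q_def Z_def p_eq)
          have "run ?r (?val \<omega>) T [] = z" "run ?r' (?val \<omega>) T [] = z'"
            using p(2) hz by (auto simp: both_follow_def p_eq intro: run_eq_of_follows)
          then have "reduced_outputs n N d t key v \<omega> = z"
              "reduced_outputs n N d t key ((v + fst key $ i) mod int N) \<omega> = z'"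
            using reduced_outputs_eq_run[OF N t key[unfolded wJ] wi \<omega>] by (simp_all add: wJ T_def)
          then show ?thesis
            using hz(3) by (simp add: e_def)
        qed
        then show "AE \<omega> in group_pool N b d. \<omega> \<in> (\<Union>p\<in>Q. {\<omega>. both_follow ?r ?r' (?val \<omega>) p}) \<longrightarrow>
            \<omega> \<in> {\<omega>. (reduced_outputs n N d t key v \<omega>, reduced_outputs n N d t key ((v + fst key $ i) mod int N) \<omega>) \<in> - ?fail}"
          by (auto simp: AE_measure_pmf_iff)
      qed simp
      finally show ?thesis
        by (simp add: vimage_def)
    qed simp
    also have "measure_pmf.prob (?real key) (- ?fail) = 1 - measure_pmf.prob (?real key) ?fail"
      using measure_pmf.prob_compl[of ?fail "?real key"] by (simp add: Compl_eq_Diff_UNIV)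
    finally show ?thesis
      by simp
  qed

  have int: "integrable (measure_pmf (keys n N)) (indicat_real A)" for A :: "((int ^ 'k) \<times> (int \<times> int)) set"
    by (intro measure_pmf.integrable_const_bound[where B = 1]) (auto simp: indicator_def)
  have "?Real = bind_pmf (keys n N) ?real"
    by (simp add: map_pmf_def)
  then have "measure_pmf.prob ?Real ?fail = (\<integral>key. measure_pmf.prob (?real key) ?fail \<partial>measure_pmf (keys n N))"
    by (simp only: prob_bind_pmf)
  also have "\<dots> \<le> (\<integral>key. 1 - (\<Sum>p\<in>Z. ideal p * (1 - indicator (Bad p) key)) \<partial>measure_pmf (keys n N))"
  proof (rule integral_mono_AE)
    show "integrable (measure_pmf (keys n N)) (\<lambda>key. measure_pmf.prob (?real key) ?fail)"
      by (intro measure_pmf.integrable_const_bound[where B = 1]) auto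
    show "AE key in keys n N. measure_pmf.prob (?real key) ?fail \<le> 1 - (\<Sum>p\<in>Z. ideal p * (1 - indicator (Bad p) key))"
      using real_le by (auto simp: AE_measure_pmf_iff)
  qed (simp add: int)
  also have "\<dots> = 1 - (\<Sum>p\<in>Z. ideal p * (1 - measure_pmf.prob (keys n N) (Bad p)))"
    by (simp add: int)
  also have "\<dots> \<le> 1 - (\<Sum>p\<in>Z. ideal p * (1 - ?\<epsilon>))"
    using Bad(1) ideal_nonneg by (intro diff_left_mono sum_mono mult_left_mono) auto
  also have "\<dots> = 1 - (\<Sum>p\<in>Z. ideal p) + (\<Sum>p\<in>Z. ideal p) * ?\<epsilon>"
    unfolding sum_distrib_right by (simp add: right_diff_distrib sum_subtractf)
  also have "(\<Sum>p\<in>Z. ideal p) * ?\<epsilon> \<le> 1 * ?\<epsilon>"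
    using sum_le by (intro mult_right_mono) auto
  finally show ?thesis
    using ideal_le by simp
qed

theorem theorem7:
  fixes n N :: nat
  assumes "n > 0" and "prime N" and "N \<ge> n"
  shows "\<exists>R :: nat \<Rightarrow> nat \<Rightarrow> 'k::finite reduction.
           \<forall>(b :: nat) (d :: nat) (\<delta> :: real) (h :: 'k lphs_tree pmf).
             noncyclic_lphs n b d \<delta> h \<longrightarrow>
               ddl_algorithm N b d (\<delta> + (real d)\<^sup>2 / real N) (apply_reduction (R b d) h) \<and>
               query_restricted n N b (apply_reduction (R b d) h)"
proof (intro exI[of _ "lphs_reduction n N"] allI impI)
  fix b d :: nat and \<delta> :: real and h :: "'k lphs_tree pmf"
  assume lphs: "noncyclic_lphs n b d \<delta> h"
  let ?A = "apply_reduction (lphs_reduction n N b d) h"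
  have tree: "at_most_queries (labels b) t d \<and> queries (labels b) t \<subseteq> {1} \<times> box n"
    if "t \<in> set_pmf (?A w)" for w t
  proof -
    obtain J G t' where t: "t = link (simulator (jump_cell N w J) (\<lambda>\<beta>. cell_query n N w (jump_cell N w J \<beta>)) G d [] []) t'"
      using \<open>t \<in> set_pmf (?A w)\<close> by (auto simp: apply_reduction_def lphs_reduction_def)
    have "queries (labels b) t \<subseteq> range (\<lambda>\<beta>. cell_query n N w (jump_cell N w J \<beta>))"
      unfolding t by (rule queries_simulator)
    also have "\<dots> \<subseteq> {1} \<times> box n"
      using cell_query_in[OF assms(1)] by blast
    finally show ?thesis
      using at_most_queries_simulator t by blast
  qed
  have "box n \<subseteq> (box N :: (int ^ 'k) set)"
  proof
    fix \<beta> :: "int ^ 'k" assume "\<beta> \<in> box n"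
    then have "0 \<le> \<beta> $ j \<and> \<beta> $ j < int N" for j
      using assms(3) by (auto simp: box_def dest!: spec[of _ j])
    then show "\<beta> \<in> box N"
      by (simp add: box_def)
  qed
  moreover have "1 \<in> {0..<int N}"
    using prime_gt_1_nat[OF assms(2)] by simp
  ultimately have sub: "{1} \<times> box n \<subseteq> {0..<int N} \<times> (box N :: (int ^ 'k) set)"
    by blast
  show "ddl_algorithm N b d (\<delta> + (real d)\<^sup>2 / real N) ?A \<and> query_restricted n N b ?A"
  proof
    show "query_restricted n N b ?A"
      unfolding query_restricted_def using tree by blast
    show "ddl_algorithm N b d (\<delta> + (real d)\<^sup>2 / real N) ?A"
      unfolding ddl_algorithm_def
    proof (intro conjI ballI allI)
      fix w t assume "t \<in> set_pmf (?A w)"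
      then show "at_most_queries (labels b) t d" "queries (labels b) t \<subseteq> {0..<int N} \<times> box N"
        using tree sub by blast+
    next
      fix i :: 'k
      let ?X = "uniform_string {0..<int N} b" and ?v = "pmf_of_set {0..<int N}"
        and ?w = "pmf_of_set (box N :: (int ^ 'k) set)"
        and ?G = "uniform_string (histories b d) b"
      let ?out = "\<lambda>t v w J X G. (reduced_outputs n N d t (w, J) v (X, G),
          reduced_outputs n N d t (w, J) ((v + w $ i) mod int N) (X, G))"
      have "do { X \<leftarrow> ?X; v \<leftarrow> ?v; w \<leftarrow> ?w; t \<leftarrow> ?A w;
              return_pmf (eval_tree t (group_oracle N X w v),
                          eval_tree t (group_oracle N X w ((v + w $ i) mod int N))) }
          = do { X \<leftarrow> ?X; v \<leftarrow> ?v; w \<leftarrow> ?w; t \<leftarrow> h; J \<leftarrow> jumps n N; G \<leftarrow> ?G;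
                 return_pmf (?out t v w J X G) }"
        by (simp add: apply_reduction_def lphs_reduction_def reduced_outputs_def pair_pmf_def map_pmf_def
            bind_assoc_pmf bind_return_pmf)
      \<comment> \<open>The draws are independent, so the tree and \<open>v\<close> can be moved to
        the front, leaving the experiment with a fixed tree and base point.\<close>
      also have "\<dots> = do { t \<leftarrow> h; X \<leftarrow> ?X; v \<leftarrow> ?v; w \<leftarrow> ?w; J \<leftarrow> jumps n N; G \<leftarrow> ?G;
                 return_pmf (?out t v w J X G) }"
        by (simp only: bind_commute_pmf[of ?w h] bind_commute_pmf[of ?v h] bind_commute_pmf[of ?X h])
      also have "\<dots> = do { t \<leftarrow> h; v \<leftarrow> ?v; w \<leftarrow> ?w; J \<leftarrow> jumps n N; X \<leftarrow> ?X; G \<leftarrow> ?G;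
                 return_pmf (?out t v w J X G) }"
        by (simp only: bind_commute_pmf[of ?X ?v] bind_commute_pmf[of ?X ?w] bind_commute_pmf[of ?X "jumps n N"])
      also have "\<dots> = do { t \<leftarrow> h; v \<leftarrow> ?v; key \<leftarrow> keys n N; \<omega> \<leftarrow> group_pool N b d;
                 return_pmf (reduced_outputs n N d t key v \<omega>,
                   reduced_outputs n N d t key ((v + fst key $ i) mod int N) \<omega>) }"
        by (simp add: keys_def group_pool_def pair_pmf_def bind_assoc_pmf bind_return_pmf)
      finally have exp: "do { X \<leftarrow> ?X; v \<leftarrow> ?v; w \<leftarrow> ?w; t \<leftarrow> ?A w;
              return_pmf (eval_tree t (group_oracle N X w v),
                          eval_tree t (group_oracle N X w ((v + w $ i) mod int N))) }
          = \<dots>" .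
      have "measure_pmf.prob (do { X \<leftarrow> ?X; v \<leftarrow> ?v; w \<leftarrow> ?w; t \<leftarrow> ?A w;
              return_pmf (eval_tree t (group_oracle N X w v),
                          eval_tree t (group_oracle N X w ((v + w $ i) mod int N))) })
            {(z, z'). z - z' \<noteq> unit_vec i}
          \<le> measure_pmf.prob (do { t \<leftarrow> h; x \<leftarrow> uniform_string (box n) b; x' \<leftarrow> noncyclic_shift n b i x;
              return_pmf (eval_tree t x, eval_tree t x') })
            {(z, z'). z \<noteq> z' + unit_vec i} + (real d)\<^sup>2 / real N"
        unfolding exp
      \<comment> \<open>The tree is a stage common to both experiments, while \<open>v\<close>
        occurs only on the left and is removed by a bound uniform in it.\<close>
      proof (rule prob_bind_pmf_mono, rule prob_bind_pmf_le)
        fix t v assume "t \<in> set_pmf h"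
        then have "at_most_queries (labels b) t d" "queries (labels b) t \<subseteq> box n"
          using lphs by (auto simp: noncyclic_lphs_def)
        then show "measure_pmf.prob (do { key \<leftarrow> keys n N; \<omega> \<leftarrow> group_pool N b d;
                 return_pmf (reduced_outputs n N d t key v \<omega>,
                   reduced_outputs n N d t key ((v + fst key $ i) mod int N) \<omega>) })
              {(z, z'). z - z' \<noteq> unit_vec i}
            \<le> measure_pmf.prob (do { x \<leftarrow> uniform_string (box n) b; x' \<leftarrow> noncyclic_shift n b i x;
                 return_pmf (eval_tree t x, eval_tree t x') })
              {(z, z'). z \<noteq> z' + unit_vec i} + (real d)\<^sup>2 / real N"
          by (rule reduction_loss[OF assms(2,3)])
      qed
      also have "\<dots> \<le> \<delta> + (real d)\<^sup>2 / real N"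
        using lphs by (auto simp: noncyclic_lphs_def)
      finally show "measure_pmf.prob (do { X \<leftarrow> ?X; v \<leftarrow> ?v; w \<leftarrow> ?w; t \<leftarrow> ?A w;
              return_pmf (eval_tree t (group_oracle N X w v),
                          eval_tree t (group_oracle N X w ((v + w $ i) mod int N))) })
            {(z, z'). z - z' \<noteq> unit_vec i} \<le> \<delta> + (real d)\<^sup>2 / real N" .
    qed
  qed
qed

end
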